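(* There exists a constant $C$ such that the following holds. Let $b\in L^1(\mathbb{R}^2)$. If the commutator $[b,H_1H_2]$ is bounded on $L^2(\mathbb{R}^2)$, then $b\in\mathrm{bmo}(\mathbb{R}\times\mathbb{R})$ and $$\|b\|_{\mathrm{bmo}(\mathbb{R}\times\mathbb{R})}\le C\,\big\|[b,H_1H_2]:L^2(\mathbb{R}^2)\to L^2(\mathbb{R}^2)\big\|.$$
   Context: The space $\mathrm{bmo}(\mathbb{R}\times\mathbb{R})$ (little BMO) consists of all $b\in L^1_{loc}(\mathbb{R}^2)$ with $$\|b\|_{\mathrm{bmo}(\mathbb{R}\times\mathbb{R})}:=\sup_{R}\frac1{|R|}\iint_R|b(x_1,x_2)-b_R|\,dx_1dx_2<\infty,\qquad b_R:=\frac1{|R|}\iint_Rb(x_1,x_2)\,dx_1dx_2,$$ where the supremum is over all rectangles $R=I\times J$ with $I,J\subset\mathbb{R}$ bounded intervals. The Hilbert transform on $\mathbb{R}$ is $Hf(x)=\int_{\mathbb{R}}\frac{f(y)}{y-x}\,dy$ (principal value); $H_1$ and $H_2$ denote the Hilbert transform acting on the first and on the second variable, respectively, of functions on $\mathbb{R}^2$. The commutator is $[b,H_1H_2]f=b\,H_1H_2f-H_1H_2(bf)$. For $b\in L^1(\mathbb{R}^2)$ it is understood through the bilinear form $$\langle[b,H_1H_2]f,g\rangle=\int_{\mathbb{R}^2}b\,\big(g\,H_1H_2f-f\,H_1H_2g\big)\,dx_1dx_2,\qquad f,g\in C_c^\infty(\mathbb{R}^2).$$ It is bounded on $L^2(\mathbb{R}^2)$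 if there is a finite $N$ with $|\langle[b,H_1H_2]f,g\rangle|\le N\|f\|_{L^2(\mathbb{R}^2)}\|g\|_{L^2(\mathbb{R}^2)}$ for all such $f,g$, and its norm is the smallest such $N$. *)

theory Defs
  imports "HOL-Analysis.Analysis"
begin

definition rectangles :: "(real \<times> real) set set" where
  "rectangles = {I \<times> J | I J. is_interval I \<and> bounded I \<and> interior I \<noteq> {} \<and>
                               is_interval J \<and> bounded J \<and> interior J \<noteq> {}}"

definition mean_on :: "(real \<times> real \<Rightarrow> complex) \<Rightarrow> (real \<times> real) set \<Rightarrow> complex" where
  "mean_on b R = (LINT x:R|lebesgue. b x) /\<^sub>R measure lebesgue R"

definition mean_oscillation :: "(real \<times> real \<Rightarrow> complex) \<Rightarrow> (real \<times> real) set \<Rightarrow> real" where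
  "mean_oscillation b R = (LINT x:R|lebesgue. norm (b x - mean_on b R)) / measure lebesgue R"

definition locally_integrable :: "(real \<times> real \<Rightarrow> complex) \<Rightarrow> bool" where
  "locally_integrable b \<longleftrightarrow> (\<forall>K. compact K \<longrightarrow> set_integrable lebesgue K b)"

definition little_bmo :: "(real \<times> real \<Rightarrow> complex) set" where
  "little_bmo = {b. locally_integrable b \<and> bdd_above (mean_oscillation b ` rectangles)}"

(* A real supremum: meaningful only for members of little_bmo. *)
definition little_bmo_norm :: "(real \<times> real \<Rightarrow> complex) \<Rightarrow> real" where
  "little_bmo_norm b = (SUP R\<in>rectangles. mean_oscillation b R)"

(* In finite dimension, f is C^(k+1) iff it is differentiable and every directional
   derivative is C^k. *)
primrec Ck :: "nat \<Rightarrow> ('a::euclidean_space \<Rightarrow> 'b::real_normed_vector) \<Rightarrow> bool" where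
  "Ck 0 f \<longleftrightarrow> continuous_on UNIV f"
| "Ck (Suc k) f \<longleftrightarrow>
     (\<exists>f'. (\<forall>x. (f has_derivative f' x) (at x)) \<and> (\<forall>v. Ck k (\<lambda>x. f' x v)))"

definition test_functions :: "(real \<times> real \<Rightarrow> complex) set" where
  "test_functions = {f. (\<forall>k. Ck k f) \<and> compact (closure {x. f x \<noteq> 0})}"

definition L2_norm :: "(real \<times> real \<Rightarrow> complex) \<Rightarrow> real" where
  "L2_norm f = sqrt (LINT x|lebesgue. (norm (f x))\<^sup>2)"

(* Principal value at the singularity y = x. The kernel is 1/(y - x), without the factor 1/pi. *)
definition hilbert :: "(real \<Rightarrow> complex) \<Rightarrow> real \<Rightarrow> complex" where
  "hilbert f x =
     Lim (at_right 0) (\<lambda>\<epsilon>. LINT y:{y. \<bar>y - x\<bar> > \<epsilon>}|lebesgue. f y / of_real (y - x))"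

definition hilbert1 :: "(real \<times> real \<Rightarrow> complex) \<Rightarrow> real \<times> real \<Rightarrow> complex" where
  "hilbert1 f = (\<lambda>(x1, x2). hilbert (\<lambda>y. f (y, x2)) x1)"

definition hilbert2 :: "(real \<times> real \<Rightarrow> complex) \<Rightarrow> real \<times> real \<Rightarrow> complex" where
  "hilbert2 f = (\<lambda>(x1, x2). hilbert (\<lambda>y. f (x1, y)) x2)"

(* Bilinear, not sesquilinear: g is not conjugated. *)
definition commutator_form ::
    "(real \<times> real \<Rightarrow> complex) \<Rightarrow> (real \<times> real \<Rightarrow> complex) \<Rightarrow> (real \<times> real \<Rightarrow> complex) \<Rightarrow> complex" where
  "commutator_form b f g =
     (LINT x|lebesgue. b x * (g x * hilbert1 (hilbert2 f) x - f x * hilbert1 (hilbert2 g) x))"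

definition commutator_bounds :: "(real \<times> real \<Rightarrow> complex) \<Rightarrow> real set" where
  "commutator_bounds b = {N. 0 \<le> N \<and>
     (\<forall>f\<in>test_functions. \<forall>g\<in>test_functions.
        norm (commutator_form b f g) \<le> N * L2_norm f * L2_norm g)}"

definition commutator_bounded :: "(real \<times> real \<Rightarrow> complex) \<Rightarrow> bool" where
  "commutator_bounded b \<longleftrightarrow> commutator_bounds b \<noteq> {}"

(* A real infimum: meaningful only if commutator_bounded b. The infimum is attained. *)
definition commutator_norm :: "(real \<times> real \<Rightarrow> complex) \<Rightarrow> real" where
  "commutator_norm b = Inf (commutator_bounds b)"

end

theory Submission
  imports Defs
begin

text \<open>
  The proof is the median method. The operator \<open>H\<^sub>1 H\<^sub>2\<close> has the kernel
  \<open>K(x, y) = 1 / ((y\<^sub>1 - x\<^sub>1) (y\<^sub>2 - x\<^sub>2))\<close>, which is symmetric in \<open>x\<close> and \<open>y\<close>. If the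
  rectangle \<open>Q\<close> has side lengths \<open>\<delta> = (l, m)\<close> and \<open>Q'\<close> is its translate by \<open>4\<delta>\<close>, then both
  factors of the denominator are positive for \<open>x \<in> Q\<close>, \<open>y \<in> Q'\<close>, and there
  \<open>K \<ge> 1 / (25 l m) = 1 / (25 \<bar>Q\<bar>)\<close>. Because the coordinates are separated, the principal
  values are ordinary integrals: for \<open>f\<close> supported near \<open>Q'\<close> and \<open>g\<close> supported near \<open>Q\<close> the bilinear form is the
  absolutely convergent double integral of \<open>(b(x) - b(y)) K(x, y) g(x) f(y)\<close>.

  Let \<open>\<alpha>\<close> be a median of \<open>Re b\<close> on \<open>Q'\<close>, and put \<open>E = {x \<in> Q. Re b(x) \<ge> \<alpha>}\<close> and
  \<open>F = {y \<in> Q'. Re b(y) \<le> \<alpha>}\<close>, so that \<open>\<bar>F\<bar> \<ge> \<bar>Q\<bar> / 2\<close>. For \<open>f = 1\<^sub>F\<close> and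
  \<open>g = 1\<^sub>E\<close> we have \<open>Re b(x) - Re b(y) \<ge> Re b(x) - \<alpha> \<ge> 0\<close> on the domain of integration. The real
  part of the form is therefore at least \<open>1/50\<close> of the integral of \<open>(Re b - \<alpha>)\<^sup>+\<close> over \<open>Q\<close>, whereas
  boundedness of the commutator makes it at most \<open>N \<bar>E\<bar>\<^sup>1\<^sup>/\<^sup>2 \<bar>F\<bar>\<^sup>1\<^sup>/\<^sup>2 \<le> N \<bar>Q\<bar>\<close>
  (\<open>positive_part_oscillation\<close>). Multiplying \<open>b\<close> by \<open>1, -1, -\<i>, \<i>\<close> does not change the norm of the
  commutator, so the negative part and the imaginary part obey the same estimate, and the four
  estimates bound the integral of \<open>\<bar>b - \<gamma>\<bar>\<close> over \<open>Q\<close> by \<open>200 N \<bar>Q\<bar>\<close> for a constant \<open>\<gamma>\<close>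
  (\<open>oscillation_on_cbox\<close>). Replacing \<open>\<gamma>\<close> by the mean of \<open>b\<close> costs a factor \<open>2\<close>, whence \<open>C = 400\<close>.

  Indicators are not test functions, and most of the work goes into passing to them
  (\<open>commutator_bound_indicators\<close>). Each indicator is the almost everywhere limit of uniformly
  bounded test functions that live in a slightly larger rectangle
  (\<open>indicator_approx_test_functions\<close>); the enlarged rectangles are still separated, so the kernel
  is bounded on them and dominated convergence applies, \<open>b\<close> being integrable.
\<close>

section \<open>Closure properties of smooth functions\<close>

text \<open>
  Lowering the order is needed for the product rule, which pairs a derivative of one factor with the
  other factor itself.
\<close>
lemma Ck_Suc_imp_Ck: "Ck (Suc k) f \<Longrightarrow> Ck k f"
proof (induction k arbitrary: f)
  case 0
  then show ?case
    by (auto intro!: continuous_at_imp_continuous_on intro: has_derivative_continuous)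
next
  case (Suc k)
  then obtain f' where "\<And>x. (f has_derivative f' x) (at x)" "\<And>v. Ck (Suc k) (\<lambda>x. f' x v)"
    by (auto simp only: Ck.simps(2)[of "Suc k"])
  with Suc.IH show ?case
    unfolding Ck.simps(2)[of k] by blast
qed

lemma Ck_SucI:
  assumes "\<And>x. (f has_derivative f' x) (at x)" "\<And>v. Ck k (\<lambda>x. f' x v)"
  shows "Ck (Suc k) f"
  using assms by auto

lemma Ck_const: "Ck k (\<lambda>x. c)"
proof (induction k arbitrary: c)
  case (Suc k)
  show ?case
    by (rule Ck_SucI[where f' = "\<lambda>x v. 0"]) (auto intro: Suc.IH)
qed auto

lemma Ck_bounded_linear: "bounded_linear f \<Longrightarrow> Ck k f"
proof (cases k)
  case (Suc m)
  assume "bounded_linear f"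
  then show ?thesis
    unfolding Suc by (intro Ck_SucI[where f' = "\<lambda>x. f"] bounded_linear_imp_has_derivative Ck_const)
qed (auto simp: linear_continuous_on)

lemma Ck_add:
  assumes "Ck k f" "Ck k g"
  shows "Ck k (\<lambda>x. f x + g x)"
  using assms
proof (induction k arbitrary: f g)
  case (Suc k)
  then obtain f' g' where d: "\<And>x. (f has_derivative f' x) (at x)" "\<And>v. Ck k (\<lambda>x. f' x v)"
    "\<And>x. (g has_derivative g' x) (at x)" "\<And>v. Ck k (\<lambda>x. g' x v)"
    by auto
  show ?case
    by (rule Ck_SucI[where f' = "\<lambda>x v. f' x v + g' x v"])
      (auto intro!: d Suc.IH has_derivative_add)
qed (auto intro: continuous_intros)

lemma Ck_mult:
  fixes f g :: "'a::euclidean_space \<Rightarrow> real"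
  assumes "Ck k f" "Ck k g"
  shows "Ck k (\<lambda>x. f x * g x)"
  using assms
proof (induction k arbitrary: f g)
  case (Suc k)
  then obtain f' g' where d: "\<And>x. (f has_derivative f' x) (at x)" "\<And>v. Ck k (\<lambda>x. f' x v)"
    "\<And>x. (g has_derivative g' x) (at x)" "\<And>v. Ck k (\<lambda>x. g' x v)"
    by auto
  show ?case
    by (rule Ck_SucI[where f' = "\<lambda>x v. f x * g' x v + f' x v * g x"])
      (auto intro!: d Suc.IH has_derivative_mult Ck_add Ck_Suc_imp_Ck[OF Suc.prems(1)]
        Ck_Suc_imp_Ck[OF Suc.prems(2)])
qed (auto intro: continuous_intros)

lemma Ck_bounded_linear_compose:
  assumes L: "bounded_linear L" and "Ck k f"
  shows "Ck k (\<lambda>x. L (f x))"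
  using assms(2)
proof (induction k arbitrary: f)
  case 0
  then show ?case
    using bounded_linear.continuous_on[OF L] by auto
next
  case (Suc k)
  then obtain f' where d: "\<And>x. (f has_derivative f' x) (at x)" "\<And>v. Ck k (\<lambda>x. f' x v)"
    by auto
  show ?case
    by (rule Ck_SucI[where f' = "\<lambda>x v. L (f' x v)"])
      (auto intro!: d Suc.IH bounded_linear.has_derivative[OF L])
qed

lemma Ck_real_polynomial_function: "real_polynomial_function f \<Longrightarrow> Ck k f"
  by (induction rule: real_polynomial_function.induct)
    (auto intro: Ck_bounded_linear Ck_const Ck_add Ck_mult)

section \<open>A smooth bump on a rectangle\<close>

text \<open>
  For \<open>n = 0\<close> this is the standard smooth function that vanishes to infinite order at the origin.
  The powers in the denominator make the family closed under differentiation up to linear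
  combinations, so that smoothness of all members follows from one induction.
\<close>
definition flat :: "nat \<Rightarrow> real \<Rightarrow> real" where
  "flat n t = (if t \<le> 0 then 0 else exp (- (1 / t)) / t ^ n)"

lemma flat_nonneg: "0 \<le> flat n t"
  by (auto simp: flat_def)

text \<open>
  Quadratic decay at the origin settles the only point where differentiability is in doubt: the
  difference quotient there is \<open>O(t)\<close>. The bound is \<open>exp s \<ge> (s / m)\<^sup>m\<close> for \<open>s = 1 / t\<close> and
  \<open>m = n + 2\<close>; the two extra powers of \<open>t\<close> survive the division by \<open>t\<^sup>n\<close>.
\<close>
lemma flat_le_square: "flat n t \<le> real (n + 2) ^ (n + 2) * t\<^sup>2"
proof (cases "t \<le> 0")
  case False
  define m where "m = n + 2"
  have m: "real m > 0" and t: "t > 0" using False by (auto simp: m_def)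
  have "1 / (t * m) \<le> exp (1 / (t * m))"
    using exp_ge_add_one_self[of "1 / (t * m)"] by linarith
  then have "(1 / (t * m)) ^ m \<le> exp (1 / (t * m)) ^ m"
    using t m by (intro power_mono) auto
  also have "\<dots> = exp (1 / t)"
    using m by (simp flip: exp_of_nat_mult)
  finally have "1 \<le> exp (1 / t) * (t ^ m * m ^ m)"
    using t m by (simp add: field_simps power_mult_distrib)
  then have "exp (- (1 / t)) \<le> t ^ m * m ^ m"
    by (simp add: exp_minus field_simps)
  then have "exp (- (1 / t)) / t ^ n \<le> t ^ m * m ^ m / t ^ n"
    using t by (intro divide_right_mono) auto
  also have "\<dots> = real m ^ m * t\<^sup>2"
  proof -
    have "t ^ m = t ^ n * t\<^sup>2" by (simp only: m_def power_add)
    then show ?thesis using t by simp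
  qed
  finally show ?thesis
    using False by (simp add: flat_def m_def)
qed (auto simp: flat_def)

lemma flat_has_derivative:
  "(flat n has_real_derivative (flat (n + 2) t - n * flat (n + 1) t)) (at t)"
proof -
  consider "t < 0" | "t > 0" | "t = 0" by linarith
  then show ?thesis
  proof cases
    case 1
    have "((\<lambda>_. 0) has_real_derivative 0) (at t)" by simp
    then have "(flat n has_real_derivative 0) (at t)"
      by (rule DERIV_cong_ev[THEN iffD1, rotated 3])
        (use 1 eventually_nhds_in_open[of "{..<0}" t] in
          \<open>auto simp: flat_def elim!: eventually_mono\<close>)
    then show ?thesis using 1 by (simp add: flat_def)
  next
    case 2
    have "((\<lambda>t. exp (- (1 / t)) / t ^ n) has_real_derivative
        (flat (n + 2) t - n * flat (n + 1) t)) (at t)"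
    proof (cases n)
      case 0
      then show ?thesis using 2
        by (auto intro!: derivative_eq_intros simp: flat_def field_simps power2_eq_square)
    next
      case (Suc m)
      have "((\<lambda>t. exp (- (1 / t)) / t ^ n) has_real_derivative
        (exp (- (1 / t)) * (1 / t\<^sup>2) * t ^ n - exp (- (1 / t)) * (real n * t ^ m)) / (t ^ n * t ^ n)) (at t)"
      proof (rule DERIV_divide)
        show "((\<lambda>t. exp (- (1 / t))) has_real_derivative exp (- (1 / t)) * (1 / t\<^sup>2)) (at t)"
          using 2 by (auto intro!: derivative_eq_intros simp: power2_eq_square)
        show "((\<lambda>t. t ^ n) has_real_derivative real n * t ^ m) (at t)"
          using DERIV_pow[of n t] Suc by simp
      qed (use 2 in auto)
      also have "(exp (- (1 / t)) * (1 / t\<^sup>2) * t ^ n - exp (- (1 / t)) * (real n * t ^ m)) / (t ^ n * t ^ n)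
          = flat (n + 2) t - n * flat (n + 1) t"
        using 2 Suc by (simp add: flat_def diff_divide_distrib power2_eq_square)
      finally show ?thesis .
    qed
    then show ?thesis
      by (rule DERIV_cong_ev[THEN iffD1, rotated 3])
        (use 2 eventually_nhds_in_open[of "{0<..}" t] in
          \<open>auto simp: flat_def elim!: eventually_mono\<close>)
  next
    case 3
    define c where "c = real (n + 2) ^ (n + 2)"
    have "((\<lambda>h. flat n h / h) \<longlongrightarrow> 0) (at 0)"
    proof (rule Lim_null_comparison)
      show "\<forall>\<^sub>F h in at 0. norm (flat n h / h) \<le> c * \<bar>h\<bar>"
      proof (rule always_eventually, rule allI)
        fix h :: real
        have "flat n h / \<bar>h\<bar> \<le> c * h\<^sup>2 / \<bar>h\<bar>"
          by (rule divide_right_mono) (use flat_le_square[of n h] in \<open>auto simp: c_def\<close>)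
        also have "c * h\<^sup>2 / \<bar>h\<bar> = c * \<bar>h\<bar>"
          by (cases "h = 0") (auto simp: power2_eq_square abs_if)
        finally show "norm (flat n h / h) \<le> c * \<bar>h\<bar>"
          using flat_nonneg[of n h] by (simp add: abs_divide)
      qed
      show "((\<lambda>h. c * \<bar>h\<bar>) \<longlongrightarrow> 0) (at 0)"
        by (auto intro!: tendsto_eq_intros)
    qed
    then show ?thesis
      using 3 by (simp add: DERIV_def flat_def)
  qed
qed

text \<open>
  Differentiating raises the index, so the induction on \<open>k\<close> must cover all \<open>n\<close> at once.
\<close>
lemma Ck_flat_affine:
  fixes u :: "'a::euclidean_space"
  shows "Ck k (\<lambda>x. flat n (u \<bullet> x + c))"
proof (induction k arbitrary: n)
  case 0
  have "continuous_on UNIV (flat n)"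
    by (intro continuous_at_imp_continuous_on ballI DERIV_isCont[OF flat_has_derivative])
  then have "continuous_on UNIV (\<lambda>x. flat n (u \<bullet> x + c))"
    by (rule continuous_on_compose2) (auto intro!: continuous_intros)
  then show ?case by simp
next
  case (Suc k)
  have d: "((\<lambda>x. flat n (u \<bullet> x + c)) has_derivative
      (\<lambda>v. (u \<bullet> v) * (flat (n + 2) (u \<bullet> x + c) + (- real n) * flat (n + 1) (u \<bullet> x + c)))) (at x)" for x
  proof -
    have "((\<lambda>x. u \<bullet> x + c) has_derivative (\<lambda>v. u \<bullet> v)) (at x)"
      by (auto intro!: derivative_eq_intros)
    from DERIV_compose_FDERIV[OF flat_has_derivative this] show ?thesis by simp
  qed
  show ?case
    by (rule Ck_SucI[OF d]) (intro Ck_mult Ck_add Ck_const Suc.IH)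
qed

definition bump :: "real \<times> real \<Rightarrow> real \<times> real \<Rightarrow> real \<times> real \<Rightarrow> real" where
  "bump p q x = flat 0 (fst x - fst p) * flat 0 (fst q - fst x)
              * (flat 0 (snd x - snd p) * flat 0 (snd q - snd x))"

lemma Ck_bump: "Ck k (bump p q)"
proof -
  have "bump p q = (\<lambda>x. flat 0 ((1, 0) \<bullet> x + - fst p) * flat 0 ((-1, 0) \<bullet> x + fst q)
              * (flat 0 ((0, 1) \<bullet> x + - snd p) * flat 0 ((0, -1) \<bullet> x + snd q)))"
    by (auto simp: bump_def inner_prod_def)
  then show ?thesis
    by (simp only:) (intro Ck_mult Ck_flat_affine)
qed

lemma flat0_bounds: "0 \<le> flat 0 t" "flat 0 t \<le> 1"
  by (auto simp: flat_def)

lemma bump_bounds: "0 \<le> bump p q x" "bump p q x \<le> 1"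
  by (auto simp: bump_def flat0_bounds intro!: mult_nonneg_nonneg mult_le_one)

lemma bump_eq_0: "x \<notin> box p q \<Longrightarrow> bump p q x = 0"
  by (auto simp: bump_def flat_def mem_box Basis_prod_def inner_prod_def)

lemma bump_pos: "x \<in> box p q \<Longrightarrow> 0 < bump p q x"
  by (auto simp: bump_def flat_def mem_box Basis_prod_def inner_prod_def)

text \<open>
  The bump provides compact support, the polynomial leaves the shape free.
\<close>
lemma bump_mult_test_function:
  assumes "real_polynomial_function P"
  shows "(\<lambda>x. complex_of_real (bump p q x * P x)) \<in> test_functions"
proof -
  have "{x. complex_of_real (bump p q x * P x) \<noteq> 0} \<subseteq> cbox p q"
  proof
    fix x
    assume "x \<in> {x. complex_of_real (bump p q x * P x) \<noteq> 0}"
    then have "bump p q x \<noteq> 0" by simp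
    then show "x \<in> cbox p q"
      using bump_eq_0[of x p q] box_subset_cbox[of p q] by blast
  qed
  then have "closure {x. complex_of_real (bump p q x * P x) \<noteq> 0} \<subseteq> cbox p q"
    by (rule closure_minimal) (rule closed_cbox)
  then have "compact (closure {x. complex_of_real (bump p q x * P x) \<noteq> 0})"
    unfolding compact_eq_bounded_closed using bounded_subset[OF bounded_cbox] closed_closure by blast
  moreover have "Ck k (\<lambda>x. complex_of_real (bump p q x * P x))" for k
    by (rule Ck_bounded_linear_compose[OF bounded_linear_of_real])
      (intro Ck_mult Ck_bump Ck_real_polynomial_function assms)
  ultimately show ?thesis
    unfolding test_functions_def by (intro CollectI conjI allI)
qed

section \<open>Approximation of indicators by test functions\<close>

text \<open>
  The inner rectangle is compact in the open outer one, so the bump \<open>w\<close> of the outer rectangle is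
  bounded below on it and \<open>1\<^sub>E / w\<close> is a bounded measurable function. It is an almost everywhere
  limit of continuous functions, and by the Stone-Weierstrass theorem these may be taken to be
  polynomials on the outer rectangle. Multiplication by \<open>w\<close> turns the polynomials into test
  functions and the limit back into the indicator.
\<close>
lemma indicator_approx_test_functions:
  assumes E: "E \<in> sets lebesgue" "E \<subseteq> cbox p q" and sub: "cbox p q \<subseteq> box p' q'"
  obtains f :: "nat \<Rightarrow> real \<times> real \<Rightarrow> real" and M :: real where
    "\<And>n. (\<lambda>x. complex_of_real (f n x)) \<in> test_functions"
    "\<And>n x. x \<notin> cbox p' q' \<Longrightarrow> f n x = 0"
    "\<And>n x. \<bar>f n x\<bar> \<le> M"
    "AE x in lebesgue. (\<lambda>n. f n x) \<longlonglongrightarrow> indicator E x"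
proof -
  define w where "w = bump p' q'"
  have cont: "continuous_on UNIV w"
    using Ck_bump[of 0] by (simp add: w_def)
  obtain c where c: "c > 0" "\<And>x. x \<in> cbox p q \<Longrightarrow> c \<le> w x"
  proof (cases "cbox p q = {}")
    case False
    then obtain z where z: "z \<in> cbox p q" "\<And>x. x \<in> cbox p q \<Longrightarrow> w z \<le> w x"
      using continuous_attains_inf[OF compact_cbox _ continuous_on_subset[OF cont subset_UNIV], of p q] by blast
    moreover have "w z > 0"
      using z(1) sub bump_pos[of z p' q'] unfolding w_def by blast
    ultimately show ?thesis using that[of "w z"] by auto
  qed (use that[of 1] in auto)
  define h where "h x = indicator E x / w x" for x
  have h0: "0 \<le> h x" and h1: "h x \<le> 1 / c" for x
  proof -
    show "0 \<le> h x"
      by (auto simp: h_def w_def bump_bounds)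
    show "h x \<le> 1 / c"
    proof (cases "x \<in> E")
      case True
      then have "c \<le> w x" using c(2) E(2) by blast
      then show ?thesis using True c(1) by (simp add: h_def frac_le)
    qed (use c(1) in \<open>simp add: h_def\<close>)
  qed
  have "w \<in> borel_measurable lebesgue"
    using cont by (simp add: borel_measurable_continuous_onI measurable_completion)
  then have "h \<in> borel_measurable lebesgue"
    unfolding h_def using E(1) by auto
  then have "h measurable_on UNIV"
    by (simp add: measurable_on_iff_borel_measurable)
  then obtain N g where N: "negligible N" and g: "\<And>n. continuous_on UNIV (g n)"
    and lim: "\<And>x. x \<notin> N \<Longrightarrow> (\<lambda>n. g n x) \<longlonglongrightarrow> h x"
    unfolding measurable_on_def by auto
  \<comment> \<open>The continuous approximants need not be uniformly bounded. Truncating them to an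
    interval that contains the range of h makes them so and keeps the limit.\<close>
  define g' where "g' n x = min (1 / c) (max 0 (g n x))" for n x
  have g'_bd: "\<bar>g' n x\<bar> \<le> 1 / c" for n x
    using c(1) by (auto simp: g'_def)
  have lim': "(\<lambda>n. g' n x) \<longlonglongrightarrow> h x" if "x \<notin> N" for x
  proof -
    have "(\<lambda>n. g' n x) \<longlonglongrightarrow> min (1 / c) (max 0 (h x))"
      unfolding g'_def by (intro tendsto_intros lim that)
    then show ?thesis using h0[of x] h1[of x] by simp
  qed
  have "\<exists>P. real_polynomial_function P \<and> (\<forall>x \<in> cbox p' q'. \<bar>g' n x - P x\<bar> < inverse (Suc n))" for n
  proof -
    have "continuous_on (cbox p' q') (g' n)"
      unfolding g'_def
      by (intro continuous_intros continuous_on_subset[OF g subset_UNIV])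
    then show ?thesis
      by (rule Stone_Weierstrass_real_polynomial_function[OF compact_cbox, of p' q' "g' n" "inverse (Suc n)"])
        auto
  qed
  then obtain P where P: "\<And>n. real_polynomial_function (P n)"
    "\<And>n x. x \<in> cbox p' q' \<Longrightarrow> \<bar>g' n x - P n x\<bar> < inverse (Suc n)"
    by metis
  define f where "f n x = w x * P n x" for n x
  show thesis
  proof (rule that[of f "1 / c + 1"])
    show "(\<lambda>x. complex_of_real (f n x)) \<in> test_functions" for n
      unfolding f_def w_def by (rule bump_mult_test_function[OF P(1)])
    show zero: "f n x = 0" if "x \<notin> cbox p' q'" for n x
    proof -
      have "x \<notin> box p' q'" using that box_subset_cbox[of p' q'] by blast
      then show ?thesis by (simp add: f_def w_def bump_eq_0)
    qed
    show "\<bar>f n x\<bar> \<le> 1 / c + 1" for n x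
    proof (cases "x \<in> cbox p' q'")
      case True
      have "inverse (real (Suc n)) \<le> 1" by (simp add: field_simps)
      with P(2)[OF True, of n] g'_bd[of n x] have "\<bar>P n x\<bar> \<le> 1 / c + 1"
        by linarith
      moreover have "\<bar>w x\<bar> \<le> 1"
        using bump_bounds[of p' q' x] by (simp add: w_def)
      ultimately have "\<bar>w x\<bar> * \<bar>P n x\<bar> \<le> 1 * (1 / c + 1)"
        by (intro mult_mono) auto
      then show ?thesis by (simp add: f_def abs_mult)
    qed (use zero c(1) in auto)
    have pt: "(\<lambda>n. f n x) \<longlonglongrightarrow> indicator E x" if "x \<notin> N" for x
    proof (cases "x \<in> box p' q'")
      case True
      then have x: "x \<in> cbox p' q'" using box_subset_cbox[of p' q'] by blast
      have "(\<lambda>n. g' n x - P n x) \<longlonglongrightarrow> 0"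
        by (rule Lim_null_comparison[OF _ LIMSEQ_inverse_real_of_nat])
          (use P(2)[OF x] in \<open>auto intro!: always_eventually less_imp_le\<close>)
      from tendsto_diff[OF lim'[OF that] this]
      have "(\<lambda>n. P n x) \<longlonglongrightarrow> h x" by simp
      then have "(\<lambda>n. w x * P n x) \<longlonglongrightarrow> w x * h x"
        by (intro tendsto_intros)
      moreover have "w x * h x = indicator E x"
        using bump_pos[OF True] by (simp add: h_def w_def)
      ultimately show ?thesis by (simp add: f_def)
    next
      case False
      then have "x \<notin> E" using E(2) sub by blast
      with False show ?thesis by (simp add: f_def w_def bump_eq_0)
    qed
    have "N \<in> null_sets lebesgue"
      using N by (simp add: negligible_iff_null_sets)
    then show "AE x in lebesgue. (\<lambda>n. f n x) \<longlonglongrightarrow> indicator E x"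
      by (rule AE_I') (use pt in auto)
  qed
qed

section \<open>The iterated Hilbert transform away from the support\<close>

text \<open>
  The truncated integrals do not depend on \<open>\<epsilon>\<close> once \<open>\<epsilon> < d\<close>, so the principal value is the limit
  of an eventually constant function.
\<close>
lemma hilbert_off_support:
  assumes "d > 0" and supp: "\<And>y. f y \<noteq> 0 \<Longrightarrow> d \<le> \<bar>y - x\<bar>"
  shows "hilbert f x = (LINT y|lebesgue. f y / of_real (y - x))"
proof -
  define I where "I = (LINT y|lebesgue. f y / of_real (y - x))"
  define J where "J \<epsilon> = (LINT y:{y. \<bar>y - x\<bar> > \<epsilon>}|lebesgue. f y / of_real (y - x))" for \<epsilon> :: real
  have "J \<epsilon> = I" if "\<epsilon> < d" for \<epsilon>
    unfolding I_def J_def set_lebesgue_integral_def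
  proof (rule Bochner_Integration.integral_cong[OF refl])
    fix y
    show "indicat_real {y. \<epsilon> < \<bar>y - x\<bar>} y *\<^sub>R (f y / complex_of_real (y - x)) =
          f y / complex_of_real (y - x)"
      using supp[of y] that by (cases "f y = 0") (auto simp: indicator_def)
  qed
  then have "\<forall>\<^sub>F \<epsilon> in at_right 0. I = J \<epsilon>"
    using \<open>d > 0\<close> by (auto simp: eventually_at_right_field intro!: exI[of _ d])
  then have "(J \<longlongrightarrow> I) (at_right 0)"
    by (rule Lim_transform_eventually[OF tendsto_const])
  then have "Lim (at_right 0) J = I"
    by (rule tendsto_Lim[rotated]) simp
  then show ?thesis
    unfolding hilbert_def J_def[abs_def] I_def .
qed

definition hilbert_kernel :: "real \<times> real \<Rightarrow> real \<times> real \<Rightarrow> real" where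
  "hilbert_kernel x y = 1 / ((fst y - fst x) * (snd y - snd x))"

text \<open>
  At a point whose two coordinates are both separated from the support of \<open>f\<close> this is
  \<open>H\<^sub>1 H\<^sub>2 f\<close>; at other points the integral may diverge and the value has no meaning.
\<close>
definition kernel_integral :: "(real \<times> real \<Rightarrow> real) \<Rightarrow> real \<times> real \<Rightarrow> real" where
  "kernel_integral f x = (LINT y|lebesgue. f y * hilbert_kernel x y)"

text \<open>
  A positive distance between the sets would not suffice: each factor of the denominator of the
  kernel has to stay away from zero.
\<close>
definition separated :: "real \<Rightarrow> real \<Rightarrow> (real \<times> real) set \<Rightarrow> (real \<times> real) set \<Rightarrow> bool" where
  "separated d e A B \<longleftrightarrow> 0 < d \<and> 0 < e \<and>
     (\<forall>x\<in>A. \<forall>y\<in>B. d \<le> \<bar>fst y - fst x\<bar> \<and> e \<le> \<bar>snd y - snd x\<bar>)"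

lemma separated_commute: "separated d e A B \<Longrightarrow> separated d e B A"
  unfolding separated_def using abs_minus_commute by metis

lemma hilbert_kernel_commute: "hilbert_kernel x y = hilbert_kernel y x"
  by (simp add: hilbert_kernel_def algebra_simps)

lemma abs_hilbert_kernel_le:
  assumes "separated d e A B" "x \<in> A" "y \<in> B"
  shows "\<bar>hilbert_kernel x y\<bar> \<le> 1 / (d * e)"
proof -
  have "d * e \<le> \<bar>fst y - fst x\<bar> * \<bar>snd y - snd x\<bar>"
    using assms by (intro mult_mono) (auto simp: separated_def)
  moreover have "0 < d * e"
    using assms by (simp add: separated_def)
  ultimately show ?thesis
    by (simp add: hilbert_kernel_def abs_mult frac_le)
qed

lemma hilbert_kernel_measurable [measurable]:
  "(\<lambda>z. hilbert_kernel (fst z) (snd z)) \<in> borel_measurable (borel \<Otimes>\<^sub>M borel)"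
proof -
  have "(\<lambda>z :: (real \<times> real) \<times> real \<times> real.
      (fst (snd z) - fst (fst z)) * (snd (snd z) - snd (fst z))) \<in> borel_measurable borel"
    by (intro borel_measurable_continuous_onI continuous_intros)
  then show ?thesis
    unfolding hilbert_kernel_def borel_prod by measurable
qed

lemma hilbert_kernel_measurable_section [measurable]: "hilbert_kernel x \<in> borel_measurable borel"
  using measurable_compose[OF measurable_Pair1' hilbert_kernel_measurable, of x] by simp

lemma hilbert_kernel_measurable_lebesgue: "hilbert_kernel x \<in> borel_measurable lebesgue"
  using hilbert_kernel_measurable_section by (simp add: measurable_completion)

text \<open>
  The right-hand side is the majorant for the dominated convergence arguments.
\<close>
lemma abs_mult_hilbert_kernel_le:
  assumes "separated d e A B" "x \<in> A"
    and "\<And>y. y \<notin> B \<Longrightarrow> f y = 0" and "\<And>y. \<bar>f y\<bar> \<le> M"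
  shows "\<bar>f y * hilbert_kernel x y\<bar> \<le> M / (d * e) * indicator B y"
proof (cases "y \<in> B")
  case True
  have "\<bar>f y\<bar> * \<bar>hilbert_kernel x y\<bar> \<le> M * (1 / (d * e))"
    using assms abs_hilbert_kernel_le[OF assms(1,2) True] order_trans[OF abs_ge_zero assms(4)]
    by (intro mult_mono) auto
  then show ?thesis using True by (simp add: abs_mult)
qed (use assms in auto)

lemma integrable_const_indicator:
  "B \<in> lmeasurable \<Longrightarrow> integrable lebesgue (\<lambda>y. c * indicator B y :: real)"
  by (auto intro!: integrable_mult_right integrable_real_indicator fmeasurableD2 simp: fmeasurable_def)

lemma integrable_mult_hilbert_kernel:
  assumes "separated d e A B" "x \<in> A" "B \<in> lmeasurable" "f \<in> borel_measurable lebesgue"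
    and "\<And>y. y \<notin> B \<Longrightarrow> f y = 0" and "\<And>y. \<bar>f y\<bar> \<le> M"
  shows "integrable lebesgue (\<lambda>y. f y * hilbert_kernel x y)"
proof (rule Bochner_Integration.integrable_bound)
  show "integrable lebesgue (\<lambda>y. M / (d * e) * indicator B y :: real)"
    by (rule integrable_const_indicator[OF assms(3)])
  show "(\<lambda>y. f y * hilbert_kernel x y) \<in> borel_measurable lebesgue"
    using assms(4) hilbert_kernel_measurable_lebesgue by measurable
  show "AE y in lebesgue. norm (f y * hilbert_kernel x y) \<le> norm (M / (d * e) * indicat_real B y)"
  proof (rule AE_I2)
    fix y
    have "\<bar>f y * hilbert_kernel x y\<bar> \<le> M / (d * e) * indicator B y"
      by (rule abs_mult_hilbert_kernel_le[OF assms(1,2)]) (use assms(5,6) in auto)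
    then show "norm (f y * hilbert_kernel x y) \<le> norm (M / (d * e) * indicat_real B y)"
      by (simp only: real_norm_def order_trans[OF _ abs_ge_self])
  qed
qed

lemma abs_kernel_integral_le:
  assumes "separated d e A B" "x \<in> A" "B \<in> lmeasurable" "f \<in> borel_measurable lebesgue"
    and "\<And>y. y \<notin> B \<Longrightarrow> f y = 0" and "\<And>y. \<bar>f y\<bar> \<le> M"
  shows "\<bar>kernel_integral f x\<bar> \<le> M / (d * e) * measure lebesgue B"
proof -
  have "\<bar>kernel_integral f x\<bar> \<le> (LINT y|lebesgue. M / (d * e) * indicator B y)"
    unfolding kernel_integral_def
  proof (rule integral_abs_bound_integral)
    show "integrable lebesgue (\<lambda>y. f y * hilbert_kernel x y)"
      by (rule integrable_mult_hilbert_kernel[OF assms(1-4)]) (use assms(5,6) in auto)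
    show "integrable lebesgue (\<lambda>y. M / (d * e) * indicat_real B y)"
      by (rule integrable_const_indicator[OF assms(3)])
    show "\<bar>f y * hilbert_kernel x y\<bar> \<le> M / (d * e) * indicator B y" for y
      by (rule abs_mult_hilbert_kernel_le[OF assms(1,2)]) (use assms(5,6) in auto)
  qed
  then show ?thesis by simp
qed

lemma kernel_integral_tendsto:
  assumes sep: "separated d e A B" "x \<in> A" and B: "B \<in> lmeasurable"
    and f: "\<And>n. f n \<in> borel_measurable lebesgue" "F \<in> borel_measurable lebesgue"
    and supp: "\<And>n y. y \<notin> B \<Longrightarrow> f n y = 0" and bd: "\<And>n y. \<bar>f n y\<bar> \<le> M"
    and lim: "AE y in lebesgue. (\<lambda>n. f n y) \<longlonglongrightarrow> F y"
  shows "(\<lambda>n. kernel_integral (f n) x) \<longlonglongrightarrow> kernel_integral F x"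
  unfolding kernel_integral_def
proof (rule integral_dominated_convergence[where w = "\<lambda>y. M / (d * e) * indicator B y"])
  show "AE y in lebesgue. (\<lambda>n. f n y * hilbert_kernel x y) \<longlonglongrightarrow> F y * hilbert_kernel x y"
    using lim by eventually_elim (intro tendsto_intros)
  show "AE y in lebesgue. norm (f n y * hilbert_kernel x y) \<le> M / (d * e) * indicator B y" for n
    using abs_mult_hilbert_kernel_le[of d e A B x "f n" M, OF sep supp bd] by (intro AE_I2) auto
  show "(\<lambda>y. F y * hilbert_kernel x y) \<in> borel_measurable lebesgue"
    "(\<lambda>y. f n y * hilbert_kernel x y) \<in> borel_measurable lebesgue" for n
    by (intro borel_measurable_times f hilbert_kernel_measurable_lebesgue)+
qed (rule integrable_const_indicator[OF B])

lemma kernel_integral_eq_lborel: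
  assumes "f \<in> borel_measurable borel"
  shows "kernel_integral f x = (LINT y|lborel. f y * hilbert_kernel x y)"
proof -
  have "(\<lambda>y. f y * hilbert_kernel x y) \<in> borel_measurable lborel"
    using assms by measurable
  then show ?thesis
    by (simp add: kernel_integral_def integral_completion)
qed

lemma borel_measurable_kernel_integral:
  assumes [measurable]: "f \<in> borel_measurable borel"
  shows "kernel_integral f \<in> borel_measurable borel"
proof -
  have "(\<lambda>x. LINT y|lborel. f y * hilbert_kernel x y) \<in> borel_measurable borel"
    by measurable
  moreover have "kernel_integral f = (\<lambda>x. LINT y|lborel. f y * hilbert_kernel x y)"
    by (rule ext) (rule kernel_integral_eq_lborel[OF assms])
  ultimately show ?thesis by simp
qed

text \<open>
  Fubini's theorem and the symmetry of the kernel. In terms of the commutator form this says that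
  constants commute with the operator, which is why a median may be subtracted from \<open>b\<close>.
\<close>
lemma integral_kernel_integral_commute:
  assumes sep: "separated d e A B" and meas: "A \<in> lmeasurable" "B \<in> lmeasurable"
    "A \<in> sets borel" "B \<in> sets borel"
    and [measurable]: "f \<in> borel_measurable borel" "g \<in> borel_measurable borel"
    and f: "\<And>y. y \<notin> B \<Longrightarrow> f y = 0" "\<And>y. \<bar>f y\<bar> \<le> M"
    and g: "\<And>y. y \<notin> A \<Longrightarrow> g y = 0" "\<And>y. \<bar>g y\<bar> \<le> M"
  shows "(LINT x|lebesgue. g x * kernel_integral f x) = (LINT y|lebesgue. f y * kernel_integral g y)"
proof -
  define h where "h x y = g x * (f y * hilbert_kernel x y)" for x y
  have h: "(\<lambda>(x, y). h x y) \<in> borel_measurable (lborel \<Otimes>\<^sub>M lborel)"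
    unfolding h_def by measurable
  have M: "0 \<le> M" using f(2) abs_ge_zero order_trans by blast
  have "integrable (lborel \<Otimes>\<^sub>M lborel) (\<lambda>(x, y). h x y)"
  proof (rule integrableI_bounded_set[where A = "A \<times> B" and B = "M * (M / (d * e))"])
    show "A \<times> B \<in> sets (lborel \<Otimes>\<^sub>M lborel)"
      using meas by auto
    have "emeasure (lborel \<Otimes>\<^sub>M lborel) (A \<times> B) = emeasure lborel A * emeasure lborel B"
      using meas by (intro lborel.emeasure_pair_measure_Times) auto
    moreover have "emeasure lborel A < \<infinity>" "emeasure lborel B < \<infinity>"
      using meas by (auto simp: fmeasurable_def)
    ultimately show "emeasure (lborel \<Otimes>\<^sub>M lborel) (A \<times> B) < \<infinity>"
      by (simp add: ennreal_mult_less_top)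
    have "\<bar>h x y\<bar> \<le> M * (M / (d * e))" if "x \<in> A" "y \<in> B" for x y
    proof -
      have "\<bar>f y * hilbert_kernel x y\<bar> \<le> M / (d * e) * indicator B y"
        by (rule abs_mult_hilbert_kernel_le[OF sep that(1)]) (use f in auto)
      then show ?thesis
        using that(2) g(2)[of x] M unfolding h_def abs_mult[of "g x"]
        by (intro mult_mono) auto
    qed
    then show "AE z in lborel \<Otimes>\<^sub>M lborel. z \<in> A \<times> B \<longrightarrow>
        norm (case z of (x, y) \<Rightarrow> h x y) \<le> M * (M / (d * e))"
      by (intro AE_I2) (simp split: prod.split)
    have "h x y = 0" if "(x, y) \<notin> A \<times> B" for x y
      using that f(1)[of y] g(1)[of x] by (auto simp: h_def)
    then show "AE z in lborel \<Otimes>\<^sub>M lborel. z \<notin> A \<times> B \<longrightarrow> (case z of (x, y) \<Rightarrow> h x y) = 0"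
      by (intro AE_I2) (simp split: prod.split)
  qed (rule h)
  then have "(LINT y|lborel. LINT x|lborel. h x y) = (LINT x|lborel. LINT y|lborel. h x y)"
    by (rule lborel_pair.Fubini_integral)
  moreover have "(LINT x|lborel. h x y) = f y * kernel_integral g y" for y
  proof -
    have "h x y = f y * (g x * hilbert_kernel y x)" for x
      unfolding h_def hilbert_kernel_commute[of x y] by (simp only: mult_ac)
    then show ?thesis
      by (simp only: kernel_integral_eq_lborel[OF assms(7)] integral_mult_right_zero)
  qed
  moreover have "(LINT y|lborel. h x y) = g x * kernel_integral f x" for x
    by (simp only: h_def kernel_integral_eq_lborel[OF assms(6)] integral_mult_right_zero)
  ultimately have "(LINT y|lborel. f y * kernel_integral g y) = (LINT x|lborel. g x * kernel_integral f x)"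
    by (simp only:)
  moreover have "(\<lambda>y. f y * kernel_integral g y) \<in> borel_measurable lborel"
    "(\<lambda>x. g x * kernel_integral f x) \<in> borel_measurable lborel"
    using borel_measurable_kernel_integral[OF assms(6)] borel_measurable_kernel_integral[OF assms(7)]
    by measurable
  ultimately show ?thesis
    by (simp add: integral_completion)
qed

text \<open>
  On each line the inner principal value is an ordinary integral, because \<open>z - x\<^sub>2\<close> stays away from
  zero on the support. As a function of \<open>y\<close> it vanishes unless the line meets the support, hence near
  \<open>x\<^sub>1\<close>, and the outer principal value is an ordinary integral too. Fubini's theorem joins the two.
\<close>
lemma hilbert1_hilbert2_off_support:
  assumes sep: "separated d e A B" and x: "x \<in> A" and B: "B \<in> lmeasurable"
    and [measurable]: "f \<in> borel_measurable borel"
    and f: "\<And>y. y \<notin> B \<Longrightarrow> f y = 0" "\<And>y. \<bar>f y\<bar> \<le> M"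
  shows "hilbert1 (hilbert2 (\<lambda>y. complex_of_real (f y))) x = of_real (kernel_integral f x)"
proof -
  obtain x1 x2 where x12: "x = (x1, x2)" by (cases x)
  have de: "0 < d" "0 < e" using sep by (auto simp: separated_def)
  define F where "F y = (LINT z|lborel. f (y, z) / (z - x2))" for y
  have sup1: "d \<le> \<bar>y - x1\<bar>" and sup2: "e \<le> \<bar>z - x2\<bar>" if "f (y, z) \<noteq> 0" for y z
  proof -
    have "(y, z) \<in> B" using that f(1) by blast
    then have "d \<le> \<bar>fst (y, z) - fst x\<bar> \<and> e \<le> \<bar>snd (y, z) - snd x\<bar>"
      using sep x unfolding separated_def by blast
    then show "d \<le> \<bar>y - x1\<bar>" "e \<le> \<bar>z - x2\<bar>"
      by (simp_all add: x12)
  qed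
  have inner: "hilbert (\<lambda>z. complex_of_real (f (y, z))) x2 = of_real (F y)" for y
  proof -
    have "hilbert (\<lambda>z. complex_of_real (f (y, z))) x2
        = (LINT z|lebesgue. of_real (f (y, z)) / of_real (z - x2))"
      by (rule hilbert_off_support[OF de(2)]) (use sup2 in auto)
    also have "\<dots> = (LINT z|lebesgue. of_real (f (y, z) / (z - x2)))" by simp
    also have "\<dots> = of_real (LINT z|lebesgue. f (y, z) / (z - x2))"
      by (rule integral_complex_of_real)
    also have "(LINT z|lebesgue. f (y, z) / (z - x2)) = F y"
      unfolding F_def by (rule integral_completion) measurable
    finally show ?thesis .
  qed
  have F0: "d \<le> \<bar>y - x1\<bar>" if "F y \<noteq> 0" for y
  proof -
    have "\<exists>z. f (y, z) \<noteq> 0"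
    proof (rule ccontr)
      assume "\<not> ?thesis"
      then have "F y = 0" by (simp add: F_def)
      with that show False by simp
    qed
    then show ?thesis using sup1 by blast
  qed
  have [measurable]: "F \<in> borel_measurable borel"
    unfolding F_def by measurable
  have "hilbert1 (hilbert2 (\<lambda>y. complex_of_real (f y))) x = hilbert (\<lambda>y. of_real (F y)) x1"
    by (simp add: hilbert1_def hilbert2_def x12 inner)
  also have "\<dots> = (LINT y|lebesgue. of_real (F y) / of_real (y - x1))"
    by (rule hilbert_off_support[OF de(1)]) (use F0 in auto)
  also have "\<dots> = (LINT y|lebesgue. of_real (F y / (y - x1)))" by simp
  also have "\<dots> = of_real (LINT y|lebesgue. F y / (y - x1))"
    by (rule integral_complex_of_real)
  also have "(LINT y|lebesgue. F y / (y - x1)) = (LINT y|lborel. F y / (y - x1))"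
    by (rule integral_completion) measurable
  also have "\<dots> = (LINT y|lborel. LINT z|lborel. f (y, z) * hilbert_kernel x (y, z))"
  proof (rule Bochner_Integration.integral_cong[OF refl])
    fix y
    have "F y / (y - x1) = (LINT z|lborel. f (y, z) / (z - x2) / (y - x1))"
      unfolding F_def by (rule integral_divide_zero[symmetric])
    then show "F y / (y - x1) = (LINT z|lborel. f (y, z) * hilbert_kernel x (y, z))"
      by (simp add: hilbert_kernel_def x12 mult.commute)
  qed
  also have "\<dots> = (LINT y|(lborel \<Otimes>\<^sub>M lborel). f y * hilbert_kernel x y)"
  proof (rule lborel_pair.integral_fst')
    have "(\<lambda>y. f y * hilbert_kernel x y) \<in> borel_measurable lborel"
      by measurable
    moreover have "integrable lebesgue (\<lambda>y. f y * hilbert_kernel x y)"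
      by (rule integrable_mult_hilbert_kernel[OF sep x B _ f]) (simp add: measurable_completion)
    ultimately have "integrable lborel (\<lambda>y. f y * hilbert_kernel x y)"
      by (simp add: integrable_completion)
    then show "integrable (lborel \<Otimes>\<^sub>M lborel) (\<lambda>y. f y * hilbert_kernel x y)"
      by (simp add: lborel_prod)
  qed
  also have "\<dots> = kernel_integral f x"
    by (simp add: lborel_prod kernel_integral_eq_lborel)
  finally show ?thesis .
qed

section \<open>The commutator form on indicators of separated sets\<close>

lemma test_function_of_real_borel:
  assumes "(\<lambda>x. complex_of_real (f x)) \<in> test_functions"
  shows "f \<in> borel_measurable borel"
proof -
  have "Ck 0 (\<lambda>x. complex_of_real (f x))"
    using assms unfolding test_functions_def by blast
  then have "continuous_on UNIV (\<lambda>x. Re (complex_of_real (f x)))"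
    by (intro continuous_on_Re) simp
  then show ?thesis
    by (intro borel_measurable_continuous_onI) simp
qed

lemma abs_pairing_le:
  assumes "separated d e A B" "B \<in> lmeasurable" "f \<in> borel_measurable lebesgue"
    and f: "\<And>y. y \<notin> B \<Longrightarrow> f y = 0" "\<And>y. \<bar>f y\<bar> \<le> M"
    and g: "\<And>x. x \<notin> A \<Longrightarrow> g x = 0" "\<And>x. \<bar>g x\<bar> \<le> M"
  shows "\<bar>g x * kernel_integral f x\<bar> \<le> M * (M / (d * e) * measure lebesgue B) * indicator A x"
proof (cases "x \<in> A")
  case True
  have "\<bar>kernel_integral f x\<bar> \<le> M / (d * e) * measure lebesgue B"
    by (rule abs_kernel_integral_le[OF assms(1) True assms(2,3)]) (use f in auto)
  then have "\<bar>g x\<bar> * \<bar>kernel_integral f x\<bar> \<le> M * (M / (d * e) * measure lebesgue B)"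
    using g(2)[of x] by (intro mult_mono) auto
  then show ?thesis using True by (simp add: abs_mult)
qed (use g in auto)

text \<open>
  The kernel integrals converge on \<open>A\<close> only; elsewhere the factors \<open>g n\<close> and \<open>G\<close> vanish.
\<close>
lemma pairing_tendsto:
  assumes sep: "separated d e A B" and B: "B \<in> lmeasurable"
    and f: "\<And>n. f n \<in> borel_measurable lebesgue" "F \<in> borel_measurable lebesgue"
      "\<And>n y. y \<notin> B \<Longrightarrow> f n y = 0" "\<And>n y. \<bar>f n y\<bar> \<le> M"
      "AE y in lebesgue. (\<lambda>n. f n y) \<longlonglongrightarrow> F y"
    and g: "\<And>n x. x \<notin> A \<Longrightarrow> g n x = 0" "\<And>x. x \<notin> A \<Longrightarrow> G x = 0"
      "AE x in lebesgue. (\<lambda>n. g n x) \<longlonglongrightarrow> G x"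
  shows "AE x in lebesgue. (\<lambda>n. g n x * kernel_integral (f n) x) \<longlonglongrightarrow> G x * kernel_integral F x"
  using g(3)
proof eventually_elim
  case (elim x)
  show ?case
  proof (cases "x \<in> A")
    case True
    show ?thesis
      by (intro tendsto_mult elim kernel_integral_tendsto[OF sep True B f(1,2)]) (use f in auto)
  qed (use g in auto)
qed

text \<open>
  Joint measurability of the kernel yields measurable kernel integrals for Borel functions. For a
  Lebesgue measurable \<open>F\<close> the kernel integral is, at every point of \<open>A\<close>, the limit of those of the
  Borel functions \<open>f n\<close>.
\<close>
lemma pairing_measurable:
  assumes sep: "separated d e A B" and B: "B \<in> lmeasurable"
    and f: "\<And>n. f n \<in> borel_measurable borel" "F \<in> borel_measurable lebesgue"
      "\<And>n y. y \<notin> B \<Longrightarrow> f n y = 0" "\<And>n y. \<bar>f n y\<bar> \<le> M"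
      "AE y in lebesgue. (\<lambda>n. f n y) \<longlonglongrightarrow> F y"
    and G: "G \<in> borel_measurable lebesgue" "\<And>x. x \<notin> A \<Longrightarrow> G x = 0"
  shows "(\<lambda>x. G x * kernel_integral F x) \<in> borel_measurable lebesgue"
proof (rule borel_measurable_LIMSEQ_metric)
  have fl: "f n \<in> borel_measurable lebesgue" for n
    using f(1)[of n] by (simp add: measurable_completion)
  have "kernel_integral (f n) \<in> borel_measurable lebesgue" for n
    using borel_measurable_kernel_integral[OF f(1)[of n]] by (simp add: measurable_completion)
  then show "(\<lambda>x. G x * kernel_integral (f n) x) \<in> borel_measurable lebesgue" for n
    by (intro borel_measurable_times G)
  show "(\<lambda>n. G x * kernel_integral (f n) x) \<longlonglongrightarrow> G x * kernel_integral F x" for x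
  proof (cases "x \<in> A")
    case True
    show ?thesis
      by (intro tendsto_mult tendsto_const kernel_integral_tendsto[OF sep True B fl f(2)]) (use f in auto)
  qed (use G in auto)
qed

text \<open>
  In each of the two products of the form, one factor is supported at points that are separated from
  the support of the other function, which is where the iterated Hilbert transform is a kernel
  integral.
\<close>
lemma commutator_form_separated:
  assumes sep: "separated d e A B" and meas: "A \<in> lmeasurable" "B \<in> lmeasurable"
    and borel: "f \<in> borel_measurable borel" "g \<in> borel_measurable borel"
    and f: "\<And>y. y \<notin> B \<Longrightarrow> f y = 0" "\<And>y. \<bar>f y\<bar> \<le> M"
    and g: "\<And>x. x \<notin> A \<Longrightarrow> g x = 0" "\<And>x. \<bar>g x\<bar> \<le> M"
  shows "commutator_form b (\<lambda>x. of_real (f x)) (\<lambda>x. of_real (g x)) =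
    (LINT x|lebesgue. b x * of_real (g x * kernel_integral f x - f x * kernel_integral g x))"
  unfolding commutator_form_def
proof (rule Bochner_Integration.integral_cong[OF refl])
  fix x :: "real \<times> real"
  have "of_real (g x) * hilbert1 (hilbert2 (\<lambda>y. complex_of_real (f y))) x
      = of_real (g x * kernel_integral f x)"
  proof (cases "x \<in> A")
    case True
    have "hilbert1 (hilbert2 (\<lambda>y. complex_of_real (f y))) x = of_real (kernel_integral f x)"
      by (rule hilbert1_hilbert2_off_support[OF sep True meas(2) borel(1)]) (use f in auto)
    then show ?thesis by simp
  qed (simp add: g)
  moreover have "of_real (f x) * hilbert1 (hilbert2 (\<lambda>y. complex_of_real (g y))) x
      = of_real (f x * kernel_integral g x)"
  proof (cases "x \<in> B")
    case True
    have "hilbert1 (hilbert2 (\<lambda>y. complex_of_real (g y))) x = of_real (kernel_integral g x)"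
      by (rule hilbert1_hilbert2_off_support[OF separated_commute[OF sep] True meas(1) borel(2)])
        (use g in auto)
    then show ?thesis by simp
  qed (simp add: f)
  ultimately show "b x * (of_real (g x) * hilbert1 (hilbert2 (\<lambda>y. complex_of_real (f y))) x -
      of_real (f x) * hilbert1 (hilbert2 (\<lambda>y. complex_of_real (g y))) x) =
      b x * of_real (g x * kernel_integral f x - f x * kernel_integral g x)"
    by (simp only: of_real_diff)
qed

lemma L2_norm_tendsto:
  assumes B: "B \<in> lmeasurable" and F: "F \<in> sets lebesgue"
    and f: "\<And>n. f n \<in> borel_measurable lebesgue" "\<And>n y. y \<notin> B \<Longrightarrow> f n y = 0" "\<And>n y. \<bar>f n y\<bar> \<le> M"
      "AE y in lebesgue. (\<lambda>n. f n y) \<longlonglongrightarrow> indicator F y"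
  shows "(\<lambda>n. L2_norm (\<lambda>x. of_real (f n x))) \<longlonglongrightarrow> sqrt (measure lebesgue F)"
proof -
  have "(\<lambda>n. LINT x|lebesgue. (f n x)\<^sup>2) \<longlonglongrightarrow> (LINT x|lebesgue. indicator F x :: real)"
  proof (rule integral_dominated_convergence[where w = "\<lambda>x. M\<^sup>2 * indicator B x"])
    show "indicat_real F \<in> borel_measurable lebesgue"
      using F by simp
    show "(\<lambda>x. (f n x)\<^sup>2) \<in> borel_measurable lebesgue" for n
      using f(1)[of n] by (rule borel_measurable_power)
    show "integrable lebesgue (\<lambda>x. M\<^sup>2 * indicator B x :: real)"
      by (rule integrable_const_indicator[OF B])
    show "AE x in lebesgue. (\<lambda>n. (f n x)\<^sup>2) \<longlonglongrightarrow> indicat_real F x"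
      using f(4)
    proof eventually_elim
      case (elim x)
      from tendsto_power[OF this, of 2] show ?case
        by (cases "x \<in> F") auto
    qed
    have "(f n x)\<^sup>2 \<le> M\<^sup>2 * indicator B x" for n x
    proof (cases "x \<in> B")
      case True
      have "(f n x)\<^sup>2 \<le> M\<^sup>2"
        by (rule abs_le_square_iff[THEN iffD1]) (use f(3)[of n x] in linarith)
      with True show ?thesis by simp
    qed (simp add: f)
    then show "AE x in lebesgue. norm ((f n x)\<^sup>2) \<le> M\<^sup>2 * indicator B x" for n
      by (intro AE_I2) simp
  qed
  then have "(\<lambda>n. sqrt (LINT x|lebesgue. (f n x)\<^sup>2)) \<longlonglongrightarrow> sqrt (measure lebesgue F)"
    using tendsto_real_sqrt by fastforce
  then show ?thesis
    by (simp add: L2_norm_def)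
qed

text \<open>
  The commutator form of the indicators of \<open>F\<close> and \<open>E\<close> is the integral of \<open>b \<phi>\<close>, but indicators are
  not test functions. Approximating both by test functions in slightly larger, still separated
  rectangles gives functions \<open>\<phi>\<^sub>n\<close> that are uniformly bounded and converge to \<open>\<phi>\<close> almost everywhere;
  since \<open>b\<close> is integrable, the integrals and the bound pass to the limit.
\<close>
lemma commutator_bound_indicators:
  fixes b :: "real \<times> real \<Rightarrow> complex"
  assumes sep: "separated d e (cbox a1 a2) (cbox b1 b2)"
    and E: "E \<in> sets lebesgue" "E \<subseteq> cbox p q" "cbox p q \<subseteq> box a1 a2"
    and F: "F \<in> sets lebesgue" "F \<subseteq> cbox r s" "cbox r s \<subseteq> box b1 b2"
    and b: "integrable lebesgue b" and N: "N \<in> commutator_bounds b"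
  defines "\<phi> \<equiv> \<lambda>x. indicator E x * kernel_integral (indicator F) x - indicator F x * kernel_integral (indicator E) x"
  shows "integrable lebesgue \<phi>" "integrable lebesgue (\<lambda>x. b x * of_real (\<phi> x))"
    "integral\<^sup>L lebesgue \<phi> = 0"
    "norm (LINT x|lebesgue. b x * of_real (\<phi> x)) \<le> N * sqrt (measure lebesgue F) * sqrt (measure lebesgue E)"
proof -
  define A B where "A = cbox a1 a2" and "B = cbox b1 b2"
  have meas: "A \<in> lmeasurable" "B \<in> lmeasurable" "A \<in> sets borel" "B \<in> sets borel"
    by (auto simp: A_def B_def)
  note sep = sep[folded A_def B_def]
  note sep' = separated_commute[OF sep]
  obtain g M1 where g: "\<And>n. (\<lambda>x. complex_of_real (g n x)) \<in> test_functions"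
    "\<And>n x. x \<notin> A \<Longrightarrow> g n x = 0" "\<And>n x. \<bar>g n x\<bar> \<le> M1"
    "AE x in lebesgue. (\<lambda>n. g n x) \<longlonglongrightarrow> indicator E x"
    unfolding A_def by (rule indicator_approx_test_functions[OF E]) blast
  obtain f M2 where f: "\<And>n. (\<lambda>x. complex_of_real (f n x)) \<in> test_functions"
    "\<And>n x. x \<notin> B \<Longrightarrow> f n x = 0" "\<And>n x. \<bar>f n x\<bar> \<le> M2"
    "AE x in lebesgue. (\<lambda>n. f n x) \<longlonglongrightarrow> indicator F x"
    unfolding B_def by (rule indicator_approx_test_functions[OF F]) blast
  define M where "M = max M1 M2"
  have bd: "\<bar>g n x\<bar> \<le> M" "\<bar>f n x\<bar> \<le> M" for n x
    using g(3)[of n x] f(3)[of n x] by (auto simp: M_def)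
  have borel: "f n \<in> borel_measurable borel" "g n \<in> borel_measurable borel" for n
    using f(1) g(1) by (auto intro: test_function_of_real_borel)
  then have leb: "f n \<in> borel_measurable lebesgue" "g n \<in> borel_measurable lebesgue" for n
    by (simp_all add: measurable_completion)
  have off: "indicat_real E x = 0" if "x \<notin> A" for x
    using that E box_subset_cbox[of a1 a2] by (auto simp: A_def indicator_def simp del: mem_box)
  have off': "indicat_real F x = 0" if "x \<notin> B" for x
    using that F box_subset_cbox[of b1 b2] by (auto simp: B_def indicator_def simp del: mem_box)
  have ind: "indicat_real E \<in> borel_measurable lebesgue" "indicat_real F \<in> borel_measurable lebesgue"
    using E F by auto
  define \<phi>n where "\<phi>n n x = g n x * kernel_integral (f n) x - f n x * kernel_integral (g n) x" for n x
  define ca where "ca = M * (M / (d * e) * measure lebesgue B)"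
  define cb where "cb = M * (M / (d * e) * measure lebesgue A)"
  have bd1: "\<bar>g n x * kernel_integral (f n) x\<bar> \<le> ca * indicator A x" for n x
    unfolding ca_def by (rule abs_pairing_le[OF sep meas(2) leb(1) f(2) bd(2) g(2) bd(1)])
  have bd2: "\<bar>f n x * kernel_integral (g n) x\<bar> \<le> cb * indicator B x" for n x
    unfolding cb_def by (rule abs_pairing_le[OF sep' meas(1) leb(2) g(2) bd(1) f(2) bd(2)])
  have c: "0 \<le> ca" "0 \<le> cb"
    using sep order_trans[OF abs_ge_zero bd(1)] by (auto simp: ca_def cb_def separated_def)
  define w where "w x = ca * indicat_real A x + cb * indicat_real B x" for x
  have w: "integrable lebesgue w"
    unfolding w_def by (intro Bochner_Integration.integrable_add integrable_const_indicator meas)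
  have \<phi>n_le: "\<bar>\<phi>n n x\<bar> \<le> w x" for n x
    using bd1[of n x] bd2[of n x] unfolding \<phi>n_def w_def by linarith
  have w_le: "w x \<le> ca + cb" for x
    using c by (auto simp: w_def indicator_def)
  have tr: "kernel_integral (f n) \<in> borel_measurable lebesgue" "kernel_integral (g n) \<in> borel_measurable lebesgue" for n
    using borel_measurable_kernel_integral[OF borel(1)[of n]] borel_measurable_kernel_integral[OF borel(2)[of n]]
    by (simp_all add: measurable_completion)
  have pm: "(\<lambda>x. g n x * kernel_integral (f n) x) \<in> borel_measurable lebesgue"
    "(\<lambda>x. f n x * kernel_integral (g n) x) \<in> borel_measurable lebesgue" for n
    by (intro borel_measurable_times leb tr)+
  have \<phi>n_meas: "\<phi>n n \<in> borel_measurable lebesgue" for n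
    unfolding \<phi>n_def by (intro borel_measurable_diff pm)
  have \<phi>_meas: "\<phi> \<in> borel_measurable lebesgue"
    unfolding \<phi>_def
    by (intro borel_measurable_diff
        pairing_measurable[OF sep meas(2) borel(1) ind(2) f(2) bd(2) f(4) ind(1) off]
        pairing_measurable[OF sep' meas(1) borel(2) ind(1) g(2) bd(1) g(4) ind(2) off'])
  have "AE x in lebesgue. (\<lambda>n. g n x * kernel_integral (f n) x) \<longlonglongrightarrow> indicator E x * kernel_integral (indicator F) x"
    by (rule pairing_tendsto[OF sep meas(2) leb(1) ind(2) f(2) bd(2) f(4) g(2) off g(4)])
  moreover have "AE x in lebesgue. (\<lambda>n. f n x * kernel_integral (g n) x) \<longlonglongrightarrow> indicator F x * kernel_integral (indicator E) x"
    by (rule pairing_tendsto[OF sep' meas(1) leb(2) ind(1) g(2) bd(1) g(4) f(2) off' f(4)])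
  ultimately have lim: "AE x in lebesgue. (\<lambda>n. \<phi>n n x) \<longlonglongrightarrow> \<phi> x"
    unfolding \<phi>n_def \<phi>_def by eventually_elim (rule tendsto_diff)
  have le_AE: "AE x in lebesgue. norm (\<phi>n n x) \<le> w x" for n
    using \<phi>n_le by (intro AE_I2) simp
  show "integrable lebesgue \<phi>"
    by (rule integrable_dominated_convergence[OF \<phi>_meas \<phi>n_meas w lim le_AE])
  have lim1: "(\<lambda>n. integral\<^sup>L lebesgue (\<phi>n n)) \<longlonglongrightarrow> integral\<^sup>L lebesgue \<phi>"
    by (rule integral_dominated_convergence[OF \<phi>_meas \<phi>n_meas w lim le_AE])
  have "integral\<^sup>L lebesgue (\<phi>n n) = 0" for n
  proof -
    have "integrable lebesgue (\<lambda>x. g n x * kernel_integral (f n) x)"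
      by (rule Bochner_Integration.integrable_bound[OF integrable_const_indicator[OF meas(1), of ca] pm(1)])
        (intro AE_I2, use bd1 c in \<open>simp add: abs_mult\<close>)
    moreover have "integrable lebesgue (\<lambda>x. f n x * kernel_integral (g n) x)"
      by (rule Bochner_Integration.integrable_bound[OF integrable_const_indicator[OF meas(2), of cb] pm(2)])
        (intro AE_I2, use bd2 c in \<open>simp add: abs_mult\<close>)
    ultimately have "integral\<^sup>L lebesgue (\<phi>n n) =
        (LINT x|lebesgue. g n x * kernel_integral (f n) x) - (LINT x|lebesgue. f n x * kernel_integral (g n) x)"
      unfolding \<phi>n_def by (rule Bochner_Integration.integral_diff)
    also have "\<dots> = 0"
    proof -
      have "(LINT x|lebesgue. g n x * kernel_integral (f n) x) = (LINT x|lebesgue. f n x * kernel_integral (g n) x)"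
        by (rule integral_kernel_integral_commute[OF sep meas borel f(2) bd(2) g(2) bd(1)])
      then show ?thesis by simp
    qed
    finally show ?thesis .
  qed
  with lim1 show "integral\<^sup>L lebesgue \<phi> = 0"
    by (simp add: LIMSEQ_const_iff)
  have b_meas: "b \<in> borel_measurable lebesgue" using b by (rule borel_measurable_integrable)
  have b\<phi>: "(\<lambda>x. b x * of_real (\<phi> x)) \<in> borel_measurable lebesgue"
    "(\<lambda>x. b x * of_real (\<phi>n n x)) \<in> borel_measurable lebesgue" for n
    by (intro borel_measurable_times b_meas measurable_compose[OF \<phi>_meas]
        measurable_compose[OF \<phi>n_meas] borel_measurable_of_real; simp)+
  have w2: "integrable lebesgue (\<lambda>x. norm (b x) * (ca + cb))"
    using b by auto
  have lim_b: "AE x in lebesgue. (\<lambda>n. b x * of_real (\<phi>n n x)) \<longlonglongrightarrow> b x * of_real (\<phi> x)"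
    using lim by eventually_elim (intro tendsto_intros)
  have le_b: "AE x in lebesgue. norm (b x * of_real (\<phi>n n x)) \<le> norm (b x) * (ca + cb)" for n
  proof (rule AE_I2)
    fix x
    have "\<bar>\<phi>n n x\<bar> \<le> ca + cb" using \<phi>n_le[of n x] w_le[of x] by linarith
    then show "norm (b x * of_real (\<phi>n n x)) \<le> norm (b x) * (ca + cb)"
      by (simp add: norm_mult mult_left_mono)
  qed
  show "integrable lebesgue (\<lambda>x. b x * of_real (\<phi> x))"
    by (rule integrable_dominated_convergence[OF b\<phi> w2 lim_b le_b])
  have lim2: "(\<lambda>n. LINT x|lebesgue. b x * of_real (\<phi>n n x)) \<longlonglongrightarrow> (LINT x|lebesgue. b x * of_real (\<phi> x))"
    by (rule integral_dominated_convergence[OF b\<phi> w2 lim_b le_b])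
  have "norm (LINT x|lebesgue. b x * of_real (\<phi>n n x))
      \<le> N * L2_norm (\<lambda>x. of_real (f n x)) * L2_norm (\<lambda>x. of_real (g n x))" for n
  proof -
    have "(LINT x|lebesgue. b x * of_real (\<phi>n n x))
        = commutator_form b (\<lambda>x. of_real (f n x)) (\<lambda>x. of_real (g n x))"
      unfolding \<phi>n_def
      by (rule commutator_form_separated[OF sep meas(1,2) borel f(2) bd(2) g(2) bd(1), symmetric])
    then show ?thesis
      using N f(1) g(1) by (simp add: commutator_bounds_def)
  qed
  then show "norm (LINT x|lebesgue. b x * of_real (\<phi> x)) \<le> N * sqrt (measure lebesgue F) * sqrt (measure lebesgue E)"
  proof (intro LIMSEQ_le[OF tendsto_norm[OF lim2]] exI[of _ 0] allI impI)
    have "(\<lambda>n. L2_norm (\<lambda>x. of_real (f n x))) \<longlonglongrightarrow> sqrt (measure lebesgue F)"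
      by (rule L2_norm_tendsto[OF meas(2) F(1) leb(1) f(2) bd(2) f(4)])
    moreover have "(\<lambda>n. L2_norm (\<lambda>x. of_real (g n x))) \<longlonglongrightarrow> sqrt (measure lebesgue E)"
      by (rule L2_norm_tendsto[OF meas(1) E(1) leb(2) g(2) bd(1) g(4)])
    ultimately show "(\<lambda>n. N * L2_norm (\<lambda>x. of_real (f n x)) * L2_norm (\<lambda>x. of_real (g n x)))
        \<longlonglongrightarrow> N * sqrt (measure lebesgue F) * sqrt (measure lebesgue E)"
      by (intro tendsto_intros)
  qed
qed

section \<open>Medians\<close>

text \<open>
  Take for \<open>\<alpha>\<close> the supremum of the \<open>t\<close> with \<open>\<bar>{h < t}\<bar> \<le> \<bar>S\<bar> / 2\<close>. The set is nonempty and bounded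
  because this measure tends to \<open>0\<close> and to \<open>\<bar>S\<bar>\<close> at the two ends. The first inequality is the limit
  of the measure from the right at \<open>\<alpha>\<close>, the second one, by complement, the limit from the left.
\<close>
lemma median_exists:
  fixes h :: "'a::euclidean_space \<Rightarrow> real"
  assumes S: "S \<in> lmeasurable" and h: "h \<in> borel_measurable lebesgue"
  obtains \<alpha> where "measure lebesgue S / 2 \<le> measure lebesgue {x\<in>S. h x \<le> \<alpha>}"
    "measure lebesgue S / 2 \<le> measure lebesgue {x\<in>S. \<alpha> \<le> h x}"
proof (cases "measure lebesgue S = 0")
  case True
  show ?thesis by (rule that[of 0]) (simp_all only: True div_0 measure_nonneg)
next
  case False
  define m where "m = measure lebesgue S"
  have m: "0 < m" using False by (simp add: m_def zero_less_measure_iff)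
  define U where "U t = measure lebesgue {x\<in>S. h x < t}" for t
  have lt_meas: "{x\<in>S. h x < t} \<in> lmeasurable" for t
  proof -
    have "{x\<in>space lebesgue. h x < t} \<in> sets lebesgue" using h by measurable
    then have "S \<inter> {x\<in>space lebesgue. h x < t} \<in> lmeasurable"
      by (rule fmeasurable_Int_fmeasurable[OF S])
    moreover have "S \<inter> {x\<in>space lebesgue. h x < t} = {x\<in>S. h x < t}" by auto
    ultimately show ?thesis by (simp only:)
  qed
  have lt_sets: "{x\<in>S. h x < t} \<in> sets lebesgue" for t
    by (rule fmeasurableD[OF lt_meas])
  have fin: "emeasure lebesgue {x\<in>S. h x < t} \<noteq> \<infinity>" for t
    using lt_meas[of t] by (auto simp: fmeasurable_def)
  have mono: "U s \<le> U t" if "s \<le> t" for s t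
    unfolding U_def by (rule measure_mono_fmeasurable[OF _ lt_sets lt_meas]) (use that in auto)
  define T where "T = {t. U t \<le> m / 2}"
  have "(\<lambda>n. U (- real n)) \<longlonglongrightarrow> measure lebesgue (\<Inter>n. {x\<in>S. h x < - real n})"
    unfolding U_def
    by (rule Lim_measure_decseq[OF image_subsetI[OF lt_sets] _ fin]) (auto simp: decseq_def)
  moreover have "(\<Inter>n. {x\<in>S. h x < - real n}) = {}"
  proof -
    have "\<exists>n. \<not> h x < - real n" for x
    proof -
      obtain n where "- h x < real n" using reals_Archimedean2 by blast
      then show ?thesis by (intro exI[of _ n]) simp
    qed
    then show ?thesis by blast
  qed
  ultimately have "(\<lambda>n. U (- real n)) \<longlonglongrightarrow> 0" by simp
  then have "\<forall>\<^sub>F n in sequentially. U (- real n) < m / 2"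
    using m by (intro order_tendstoD) auto
  then obtain n where "U (- real n) < m / 2"
    by (auto dest: eventually_happens)
  then have T_ne: "T \<noteq> {}" unfolding T_def using less_imp_le by blast
  have "(\<lambda>n. U (real n)) \<longlonglongrightarrow> measure lebesgue (\<Union>n. {x\<in>S. h x < real n})"
    unfolding U_def
  proof (rule Lim_measure_incseq)
    have "(\<Union>n. {x\<in>S. h x < real n}) = S"
      using reals_Archimedean2[of "h _"] by auto
    then show "emeasure lebesgue (\<Union>n. {x\<in>S. h x < real n}) \<noteq> \<infinity>"
      using S by (auto simp: fmeasurable_def)
    show "range (\<lambda>n. {x\<in>S. h x < real n}) \<subseteq> sets lebesgue"
      by (intro image_subsetI lt_sets)
  qed (auto simp: incseq_def)
  moreover have "(\<Union>n. {x\<in>S. h x < real n}) = S"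
    using reals_Archimedean2[of "h _"] by auto
  ultimately have "(\<lambda>n. U (real n)) \<longlonglongrightarrow> m" by (simp add: m_def)
  then have "\<forall>\<^sub>F n in sequentially. m / 2 < U (real n)"
    using m by (intro order_tendstoD) auto
  then obtain n' where n': "m / 2 < U (real n')"
    by (auto dest: eventually_happens)
  have T_bdd: "bdd_above T"
  proof (rule bdd_aboveI[of _ "real n'"])
    fix t assume "t \<in> T"
    then have "U t \<le> m / 2" by (simp add: T_def)
    then show "t \<le> real n'"
      using mono[of "real n'" t] n' by linarith
  qed
  define \<alpha> where "\<alpha> = Sup T"
  have above: "m / 2 < U t" if "\<alpha> < t" for t
  proof (rule ccontr)
    assume "\<not> m / 2 < U t"
    then have "t \<in> T" by (simp add: T_def)
    then have "t \<le> \<alpha>" unfolding \<alpha>_def by (rule cSup_upper[OF _ T_bdd])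
    with that show False by simp
  qed
  have below: "U t \<le> m / 2" if t: "t < \<alpha>" for t
  proof -
    obtain s where "s \<in> T" "t < s"
      using t less_cSup_iff[OF T_ne T_bdd, of t] unfolding \<alpha>_def by blast
    then show ?thesis using mono[of t s] by (simp add: T_def)
  qed
  have lim0: "(\<lambda>n. inverse (real (Suc n))) \<longlonglongrightarrow> 0" by (rule LIMSEQ_inverse_real_of_nat)
  have anti: "inverse (real (Suc n)) \<le> inverse (real (Suc k))" if "k \<le> n" for k n
    using that by (simp add: field_simps)
  have "(\<lambda>n. U (\<alpha> + inverse (real (Suc n)))) \<longlonglongrightarrow>
      measure lebesgue (\<Inter>n. {x\<in>S. h x < \<alpha> + inverse (real (Suc n))})"
    unfolding U_def
  proof (rule Lim_measure_decseq)
    show "decseq (\<lambda>n. {x\<in>S. h x < \<alpha> + inverse (real (Suc n))})"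
    proof (unfold decseq_def, intro allI impI subsetI)
      fix k n x assume "k \<le> n" and x: "x \<in> {x\<in>S. h x < \<alpha> + inverse (real (Suc n))}"
      have "h x < \<alpha> + inverse (real (Suc n))" using x by blast
      with anti[OF \<open>k \<le> n\<close>] have "h x < \<alpha> + inverse (real (Suc k))" by linarith
      with x show "x \<in> {x\<in>S. h x < \<alpha> + inverse (real (Suc k))}" by blast
    qed
  qed (intro image_subsetI lt_sets fin)+
  moreover have "(\<Inter>n. {x\<in>S. h x < \<alpha> + inverse (real (Suc n))}) = {x\<in>S. h x \<le> \<alpha>}"
  proof -
    have "h x \<le> \<alpha>" if "\<And>n. h x < \<alpha> + inverse (real (Suc n))" for x
    proof (rule LIMSEQ_le_const)
      show "(\<lambda>n. \<alpha> + inverse (real (Suc n))) \<longlonglongrightarrow> \<alpha>"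
        using tendsto_add[OF tendsto_const[of \<alpha>] lim0] by simp
      show "\<exists>N. \<forall>n\<ge>N. h x \<le> \<alpha> + inverse (real (Suc n))"
        by (intro exI[of _ 0] allI impI less_imp_le that)
    qed
    moreover have "h x < \<alpha> + inverse (real (Suc n))" if "h x \<le> \<alpha>" for x n
      using that by (intro le_less_trans[OF that]) simp
    ultimately show ?thesis by blast
  qed
  ultimately have "(\<lambda>n. U (\<alpha> + inverse (real (Suc n)))) \<longlonglongrightarrow> measure lebesgue {x\<in>S. h x \<le> \<alpha>}"
    by (simp only:)
  then have 1: "m / 2 \<le> measure lebesgue {x\<in>S. h x \<le> \<alpha>}"
    by (rule LIMSEQ_le_const) (intro exI allI impI less_imp_le above; simp)
  have "(\<lambda>n. U (\<alpha> - inverse (real (Suc n)))) \<longlonglongrightarrow>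
      measure lebesgue (\<Union>n. {x\<in>S. h x < \<alpha> - inverse (real (Suc n))})"
    unfolding U_def
  proof (rule Lim_measure_incseq)
    show "incseq (\<lambda>n. {x\<in>S. h x < \<alpha> - inverse (real (Suc n))})"
    proof (unfold incseq_def, intro allI impI subsetI)
      fix k n x assume "k \<le> n" and x: "x \<in> {x\<in>S. h x < \<alpha> - inverse (real (Suc k))}"
      have "h x < \<alpha> - inverse (real (Suc k))" using x by blast
      with anti[OF \<open>k \<le> n\<close>] have "h x < \<alpha> - inverse (real (Suc n))" by linarith
      with x show "x \<in> {x\<in>S. h x < \<alpha> - inverse (real (Suc n))}" by blast
    qed
    have "(\<Union>n. {x\<in>S. h x < \<alpha> - inverse (real (Suc n))}) \<subseteq> S" by blast
    then have "emeasure lebesgue (\<Union>n. {x\<in>S. h x < \<alpha> - inverse (real (Suc n))}) \<le> emeasure lebesgue S"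
      using S by (intro emeasure_mono) (auto simp: fmeasurableD)
    then show "emeasure lebesgue (\<Union>n. {x\<in>S. h x < \<alpha> - inverse (real (Suc n))}) \<noteq> \<infinity>"
      using S by (auto simp: fmeasurable_def top_unique)
  qed (intro image_subsetI lt_sets)
  moreover have "(\<Union>n. {x\<in>S. h x < \<alpha> - inverse (real (Suc n))}) = {x\<in>S. h x < \<alpha>}"
  proof -
    have "\<exists>n. h x < \<alpha> - inverse (real (Suc n))" if "h x < \<alpha>" for x
    proof -
      obtain n where "inverse (real (Suc n)) < \<alpha> - h x"
        using reals_Archimedean[of "\<alpha> - h x"] \<open>h x < \<alpha>\<close> by auto
      then show ?thesis by (intro exI[of _ n]) linarith
    qed
    moreover have "h x < \<alpha>" if "h x < \<alpha> - inverse (real (Suc n))" for x n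
    proof -
      have "0 < inverse (real (Suc n))" by simp
      with that show ?thesis by linarith
    qed
    ultimately show ?thesis by blast
  qed
  ultimately have "(\<lambda>n. U (\<alpha> - inverse (real (Suc n)))) \<longlonglongrightarrow> U \<alpha>"
    by (simp only: U_def)
  then have "U \<alpha> \<le> m / 2"
    by (rule LIMSEQ_le_const2) (intro exI allI impI below; simp)
  moreover have "measure lebesgue {x\<in>S. \<alpha> \<le> h x} = m - U \<alpha>"
  proof -
    have "{x\<in>S. \<alpha> \<le> h x} = S - {x\<in>S. h x < \<alpha>}" by auto
    then show ?thesis
      unfolding m_def U_def
      by (simp only:) (rule measurable_measure_Diff[OF S fmeasurableD[OF lt_meas]], blast)
  qed
  ultimately have 2: "m / 2 \<le> measure lebesgue {x\<in>S. \<alpha> \<le> h x}" by simp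
  show ?thesis by (rule that[OF 1[unfolded m_def] 2[unfolded m_def]])
qed

section \<open>The oscillation estimate\<close>

lemma mem_cbox_real_prod:
  "x \<in> cbox p q \<longleftrightarrow> fst p \<le> fst x \<and> fst x \<le> fst q \<and> snd p \<le> snd x \<and> snd x \<le> snd q"
  for x p q :: "real \<times> real"
  by (cases x; cases p; cases q) (auto simp: cbox_Pair_eq)

lemma mem_box_real_prod:
  "x \<in> box p q \<longleftrightarrow> fst p < fst x \<and> fst x < fst q \<and> snd p < snd x \<and> snd x < snd q"
  for x p q :: "real \<times> real"
  by (auto simp: mem_box Basis_prod_def inner_prod_def)

lemma measure_cbox_real_prod:
  fixes p q :: "real \<times> real"
  assumes "fst p \<le> fst q" "snd p \<le> snd q"
  shows "measure lebesgue (cbox p q) = (fst q - fst p) * (snd q - snd p)"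
  using assms content_Pair[of "fst p" "snd p" "fst q" "snd q"] by simp

text \<open>
  The core of the median method: the commutator form is tested on the sets where \<open>Re b \<ge> \<alpha>\<close> in \<open>Q\<close>
  and where \<open>Re b \<le> \<alpha>\<close> in \<open>Q'\<close>, so that the integrand \<open>(b(x) - b(y)) K(x, y)\<close> has a real part of one
  sign and no cancellation occurs.
\<close>
lemma positive_part_oscillation:
  fixes b :: "real \<times> real \<Rightarrow> complex" and p q :: "real \<times> real"
  assumes b: "integrable lebesgue b" and N: "N \<in> commutator_bounds b"
    and pq: "fst p < fst q" "snd p < snd q"
  defines "\<delta> \<equiv> q - p"
  defines "Q \<equiv> cbox p q" and "Q' \<equiv> cbox (p + 4 *\<^sub>R \<delta>) (q + 4 *\<^sub>R \<delta>)"
  assumes half: "measure lebesgue Q' / 2 \<le> measure lebesgue {y \<in> Q'. Re (b y) \<le> \<alpha>}"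
  shows "(LINT x:Q|lebesgue. max 0 (Re (b x) - \<alpha>)) \<le> 50 * N * measure lebesgue Q"
proof -
  define l m where "l = fst \<delta>" and "m = snd \<delta>"
  have lm: "0 < l" "0 < m" using pq by (auto simp: l_def m_def \<delta>_def)
  have q: "fst q = fst p + l" "snd q = snd p + m" by (auto simp: l_def m_def \<delta>_def)
  note mem = mem_cbox_real_prod mem_box_real_prod
  note coord = q l_def[symmetric] m_def[symmetric]
  \<comment> \<open>The indicators are approximated within rectangles enlarged by one side length on
    each side; a gap of one side length remains between them.\<close>
  define A1 A2 B1 B2 where "A1 = p - \<delta>" and "A2 = q + \<delta>" and "B1 = p + 3 *\<^sub>R \<delta>" and "B2 = q + 5 *\<^sub>R \<delta>"
  have Q: "Q \<in> lmeasurable" "Q' \<in> lmeasurable" by (auto simp: Q_def Q'_def)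
  have mQ: "measure lebesgue Q = l * m" "measure lebesgue Q' = l * m"
    unfolding Q_def Q'_def using lm by (subst measure_cbox_real_prod; simp add: coord)+
  define E F where "E = {x \<in> Q. \<alpha> \<le> Re (b x)}" and "F = {y \<in> Q'. Re (b y) \<le> \<alpha>}"
  have b_meas: "b \<in> borel_measurable lebesgue" using b by (rule borel_measurable_integrable)
  then have Re_meas: "(\<lambda>x. Re (b x)) \<in> borel_measurable lebesgue" by measurable
  have EF: "E \<in> lmeasurable" "F \<in> lmeasurable"
  proof -
    have "{x\<in>space lebesgue. \<alpha> \<le> Re (b x)} \<in> sets lebesgue" "{x\<in>space lebesgue. Re (b x) \<le> \<alpha>} \<in> sets lebesgue"
      using Re_meas by measurable
    then have "Q \<inter> {x\<in>space lebesgue. \<alpha> \<le> Re (b x)} \<in> lmeasurable"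
      "Q' \<inter> {x\<in>space lebesgue. Re (b x) \<le> \<alpha>} \<in> lmeasurable"
      using Q by (blast intro: fmeasurable_Int_fmeasurable)+
    moreover have "Q \<inter> {x\<in>space lebesgue. \<alpha> \<le> Re (b x)} = E" "Q' \<inter> {x\<in>space lebesgue. Re (b x) \<le> \<alpha>} = F"
      by (auto simp: E_def F_def)
    ultimately show "E \<in> lmeasurable" "F \<in> lmeasurable"
      by (simp_all only:)
  qed
  have disj: "x \<notin> Q'" if "x \<in> Q" for x
    using that lm unfolding Q_def Q'_def mem by (auto simp: coord)
  have sep: "separated l m (cbox A1 A2) (cbox B1 B2)"
    unfolding separated_def
  proof (intro conjI ballI lm)
    fix x y assume "x \<in> cbox A1 A2" "y \<in> cbox B1 B2"
    then show "l \<le> \<bar>fst y - fst x\<bar>" "m \<le> \<bar>snd y - snd x\<bar>"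
      using lm by (simp_all add: A1_def A2_def B1_def B2_def mem coord)
  qed
  have sub1: "cbox p q \<subseteq> box A1 A2"
    using lm unfolding A1_def A2_def by (auto simp: mem coord)
  have sub2: "cbox (p + 4 *\<^sub>R \<delta>) (q + 4 *\<^sub>R \<delta>) \<subseteq> box B1 B2"
    using lm unfolding B1_def B2_def by (auto simp: mem coord)
  have EQ: "E \<subseteq> cbox p q" and FQ: "F \<subseteq> cbox (p + 4 *\<^sub>R \<delta>) (q + 4 *\<^sub>R \<delta>)"
    by (auto simp: E_def F_def Q_def Q'_def)
  have hilbert_kernel_ge: "1 / (25 * (l * m)) \<le> hilbert_kernel x y" if "x \<in> Q" "y \<in> Q'" for x y
  proof -
    have "0 < fst y - fst x" "fst y - fst x \<le> 5 * l" "0 < snd y - snd x" "snd y - snd x \<le> 5 * m"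
      using that lm unfolding Q_def Q'_def mem by (auto simp: coord)
    note d = this
    have "(fst y - fst x) * (snd y - snd x) \<le> (5 * l) * (5 * m)"
      by (rule mult_mono) (use d lm in auto)
    moreover have "0 < (fst y - fst x) * (snd y - snd x)"
      using d by (intro mult_pos_pos)
    ultimately show ?thesis
      unfolding hilbert_kernel_def by (intro divide_left_mono) (use lm in auto)
  qed
  \<comment> \<open>The set F fills at least half of the translate, so integrating the lower bound of the kernel
    gives at least half of 1/25.\<close>
  have TF: "1 / 50 \<le> kernel_integral (indicator F) x" if "x \<in> Q" for x
  proof -
    have x: "x \<in> cbox A1 A2" using that sub1 box_subset_cbox[of A1 A2] unfolding Q_def by blast
    have "(LINT y|lebesgue. 1 / (25 * (l * m)) * indicator F y) \<le> kernel_integral (indicator F) x"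
      unfolding kernel_integral_def
    proof (rule integral_mono)
      show "integrable lebesgue (\<lambda>y. 1 / (25 * (l * m)) * indicat_real F y)"
        by (rule integrable_const_indicator[OF EF(2)])
      show "integrable lebesgue (\<lambda>y. indicat_real F y * hilbert_kernel x y)"
      proof (rule integrable_mult_hilbert_kernel[OF sep x, where M = 1])
        show "indicat_real F y = 0" if "y \<notin> cbox B1 B2" for y
          using that FQ sub2 box_subset_cbox[of B1 B2] by (auto simp: indicator_def simp del: mem_box)
      qed (use EF in \<open>auto simp: fmeasurableD indicator_def\<close>)
      show "1 / (25 * (l * m)) * indicat_real F y \<le> indicat_real F y * hilbert_kernel x y" for y
        using hilbert_kernel_ge[OF that, of y] by (auto simp: indicator_def F_def)
    qed
    moreover have "1 / (25 * (l * m)) * (l * m / 2) \<le> 1 / (25 * (l * m)) * measure lebesgue F"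
      using half lm unfolding F_def mQ by (intro mult_left_mono) auto
    moreover have "1 / (25 * (l * m)) * (l * m / 2) = 1 / 50"
      using lm by simp
    ultimately show ?thesis by simp
  qed
  have TE: "0 \<le> kernel_integral (indicator E) y" if "y \<in> Q'" for y
    unfolding kernel_integral_def
  proof (rule integral_nonneg_AE, rule AE_I2)
    fix x
    have "0 \<le> hilbert_kernel y x" if "x \<in> Q"
      using order_trans[OF _ hilbert_kernel_ge[OF that \<open>y \<in> Q'\<close>]] lm by (simp add: hilbert_kernel_commute[of y x])
    then show "0 \<le> indicat_real E x * hilbert_kernel y x"
      by (auto simp: indicator_def E_def)
  qed
  define \<phi> where
    "\<phi> = (\<lambda>x. indicator E x * kernel_integral (indicator F) x - indicator F x * kernel_integral (indicator E) x)"
  have sets: "E \<in> sets lebesgue" "F \<in> sets lebesgue" using EF by (auto simp: fmeasurableD)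
  have bound: "integrable lebesgue \<phi>" "integrable lebesgue (\<lambda>x. b x * of_real (\<phi> x))"
    "integral\<^sup>L lebesgue \<phi> = 0"
    "norm (LINT x|lebesgue. b x * of_real (\<phi> x)) \<le> N * sqrt (measure lebesgue F) * sqrt (measure lebesgue E)"
    unfolding \<phi>_def by (rule commutator_bound_indicators[OF sep sets(1) EQ sub1 sets(2) FQ sub2 b N])+
  have int_Re: "integrable lebesgue (\<lambda>x. Re (b x * of_real (\<phi> x)))"
    by (rule integrable_Re[OF bound(2)])
  have int_\<alpha>: "integrable lebesgue (\<lambda>x. \<alpha> * \<phi> x)"
    by (rule integrable_mult_right[OF bound(1)])
  \<comment> \<open>On E the density is at least 1/50. On F both factors are nonpositive, so this part
    of the form is nonnegative. Subtracting the median is free because the density has integral zero.\<close>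
  have pt: "1 / 50 * (indicator Q x * max 0 (Re (b x) - \<alpha>)) \<le> Re (b x * of_real (\<phi> x)) - \<alpha> * \<phi> x" for x
  proof -
    have eq: "Re (b x * of_real (\<phi> x)) - \<alpha> * \<phi> x = (Re (b x) - \<alpha>) * \<phi> x"
      by (simp add: algebra_simps)
    consider "x \<in> E" | "x \<in> F" | "x \<notin> E" "x \<notin> F" by blast
    then show ?thesis
    proof cases
      case 1
      then have x: "x \<in> Q" "x \<notin> F" "\<alpha> \<le> Re (b x)" using disj[of x] by (auto simp: E_def F_def)
      have "(Re (b x) - \<alpha>) * (1 / 50) \<le> (Re (b x) - \<alpha>) * kernel_integral (indicator F) x"
        using TF[OF x(1)] x(3) by (intro mult_left_mono) auto
      moreover have "\<phi> x = kernel_integral (indicator F) x"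
        using 1 x by (simp add: \<phi>_def)
      moreover have "indicator Q x * max 0 (Re (b x) - \<alpha>) = Re (b x) - \<alpha>"
        using x by simp
      ultimately show ?thesis unfolding eq by (simp only: mult.commute)
    next
      case 2
      then have x: "x \<in> Q'" "x \<notin> Q" "x \<notin> E" "Re (b x) \<le> \<alpha>" using disj[of x] by (auto simp: E_def F_def)
      have "0 \<le> (Re (b x) - \<alpha>) * - kernel_integral (indicator E) x"
        using TE[OF x(1)] x(4) by (intro mult_nonpos_nonpos) auto
      moreover have "\<phi> x = - kernel_integral (indicator E) x"
        using 2 x by (simp add: \<phi>_def)
      ultimately show ?thesis unfolding eq using x by simp
    next
      case 3
      then have "indicator Q x * max 0 (Re (b x) - \<alpha>) = 0"
        by (auto simp: E_def indicator_def)
      moreover have "\<phi> x = 0" using 3 by (simp add: \<phi>_def)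
      ultimately show ?thesis unfolding eq by (simp only: mult_zero_right order_refl)
    qed
  qed
  have int: "integrable lebesgue (\<lambda>x. indicator Q x * max 0 (Re (b x) - \<alpha>))"
  proof (rule Bochner_Integration.integrable_bound)
    show "integrable lebesgue (\<lambda>x. norm (b x) + \<bar>\<alpha>\<bar> * indicator Q x)"
      by (intro Bochner_Integration.integrable_add integrable_norm b integrable_const_indicator Q)
    show "(\<lambda>x. indicator Q x * max 0 (Re (b x) - \<alpha>)) \<in> borel_measurable lebesgue"
      using Re_meas Q by (intro borel_measurable_times borel_measurable_max borel_measurable_diff) (auto simp: fmeasurableD)
    show "AE x in lebesgue. norm (indicator Q x * max 0 (Re (b x) - \<alpha>)) \<le> norm (norm (b x) + \<bar>\<alpha>\<bar> * indicator Q x)"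
    proof (rule AE_I2)
      fix x
      show "norm (indicator Q x * max 0 (Re (b x) - \<alpha>)) \<le> norm (norm (b x) + \<bar>\<alpha>\<bar> * indicator Q x)"
        using abs_Re_le_cmod[of "b x"] by (auto simp: indicator_def)
    qed
  qed
  have "1 / 50 * (LINT x:Q|lebesgue. max 0 (Re (b x) - \<alpha>)) = (LINT x|lebesgue. 1 / 50 * (indicator Q x * max 0 (Re (b x) - \<alpha>)))"
    by (simp add: set_lebesgue_integral_def)
  also have "\<dots> \<le> (LINT x|lebesgue. Re (b x * of_real (\<phi> x)) - \<alpha> * \<phi> x)"
    by (intro integral_mono integrable_mult_right int Bochner_Integration.integrable_diff int_Re int_\<alpha> pt)
  also have "\<dots> = (LINT x|lebesgue. Re (b x * of_real (\<phi> x))) - (LINT x|lebesgue. \<alpha> * \<phi> x)"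
    by (rule Bochner_Integration.integral_diff[OF int_Re int_\<alpha>])
  also have "\<dots> = Re (LINT x|lebesgue. b x * of_real (\<phi> x))"
    using integral_Re[OF bound(2)] bound(3) by simp
  also have "\<dots> \<le> N * sqrt (measure lebesgue F) * sqrt (measure lebesgue E)"
    using complex_Re_le_cmod bound(4) by (rule order_trans)
  also have "\<dots> \<le> N * sqrt (l * m) * sqrt (l * m)"
  proof -
    have "measure lebesgue F \<le> l * m" "measure lebesgue E \<le> l * m"
      using mQ Q EF measure_mono_fmeasurable[of F Q' lebesgue] measure_mono_fmeasurable[of E Q lebesgue]
      by (auto simp: E_def F_def fmeasurableD)
    moreover have "0 \<le> N" using N by (simp add: commutator_bounds_def)
    ultimately show ?thesis using lm by (intro mult_mono real_sqrt_le_mono) auto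
  qed
  also have "\<dots> = N * (l * m)"
    using lm by (simp add: mult.assoc)
  finally show ?thesis by (simp add: mQ)
qed

lemma commutator_bounds_mult_unit:
  assumes "N \<in> commutator_bounds b" "norm c = 1"
  shows "N \<in> commutator_bounds (\<lambda>x. c * b x)"
proof -
  have "commutator_form (\<lambda>x. c * b x) f g = c * commutator_form b f g" for f g
    unfolding commutator_form_def by (simp only: mult.assoc integral_mult_right_zero)
  then show ?thesis
    using assms by (simp add: commutator_bounds_def norm_mult)
qed

lemma set_integrable_const_lmeasurable:
  fixes c :: "'b::{banach,second_countable_topology}"
  assumes "R \<in> lmeasurable"
  shows "set_integrable lebesgue R (\<lambda>x. c)"
  using assms by (auto simp: set_integrable_def fmeasurable_def)

lemma set_integrable_lmeasurable:
  fixes b :: "'a::euclidean_space \<Rightarrow> 'b::{banach,second_countable_topology}"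
  assumes "R \<in> lmeasurable" "integrable lebesgue b"
  shows "set_integrable lebesgue R b"
  using assms by (auto simp: set_integrable_def fmeasurableD intro!: integrable_mult_indicator)

text \<open>
  The real part of \<open>c b\<close> runs through \<open>Re b, -Re b, Im b, -Im b\<close> for \<open>c = 1, -1, -\<i>, \<i>\<close>. The
  one-sided estimate applies to all four: if \<open>\<alpha>\<close> is a median of \<open>Re b\<close>, then \<open>-\<alpha>\<close> is one of
  \<open>-Re b\<close>.
\<close>
lemma oscillation_on_cbox:
  fixes b :: "real \<times> real \<Rightarrow> complex" and p q :: "real \<times> real"
  assumes b: "integrable lebesgue b" and N: "N \<in> commutator_bounds b"
    and pq: "fst p < fst q" "snd p < snd q"
  obtains \<gamma> where "(LINT x:cbox p q|lebesgue. norm (b x - \<gamma>)) \<le> 200 * N * measure lebesgue (cbox p q)"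
proof -
  define Q where "Q = cbox p q"
  define Q' where "Q' = cbox (p + 4 *\<^sub>R (q - p)) (q + 4 *\<^sub>R (q - p))"
  have Q: "Q \<in> lmeasurable" "Q' \<in> lmeasurable" by (auto simp: Q_def Q'_def)
  have "b \<in> borel_measurable lebesgue" using b by (rule borel_measurable_integrable)
  then have meas: "(\<lambda>x. Re (b x)) \<in> borel_measurable lebesgue" "(\<lambda>x. Im (b x)) \<in> borel_measurable lebesgue"
    by measurable
  obtain \<alpha> where \<alpha>: "measure lebesgue Q' / 2 \<le> measure lebesgue {x\<in>Q'. Re (b x) \<le> \<alpha>}"
    "measure lebesgue Q' / 2 \<le> measure lebesgue {x\<in>Q'. \<alpha> \<le> Re (b x)}"
    by (rule median_exists[OF Q(2) meas(1)])
  obtain \<beta> where \<beta>: "measure lebesgue Q' / 2 \<le> measure lebesgue {x\<in>Q'. Im (b x) \<le> \<beta>}"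
    "measure lebesgue Q' / 2 \<le> measure lebesgue {x\<in>Q'. \<beta> \<le> Im (b x)}"
    by (rule median_exists[OF Q(2) meas(2)])
  have part: "(LINT x:Q|lebesgue. max 0 (Re (c * b x) - t)) \<le> 50 * N * measure lebesgue Q"
    if "norm c = 1" "measure lebesgue Q' / 2 \<le> measure lebesgue {x\<in>Q'. Re (c * b x) \<le> t}" for c t
    unfolding Q_def
  proof (rule positive_part_oscillation[OF _ commutator_bounds_mult_unit[OF N that(1)] pq])
    show "integrable lebesgue (\<lambda>x. c * b x)"
      by (rule integrable_mult_right[OF b])
  qed (rule that(2)[unfolded Q'_def])
  define h where "h c t x = max 0 (Re (c * b x) - t)" for c t x
  have h_int: "set_integrable lebesgue Q (h c t)" for c t
  proof -
    have "set_integrable lebesgue Q (\<lambda>x. c * b x - of_real t)"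
      using b by (intro set_integral_diff set_integrable_const_lmeasurable set_integrable_lmeasurable Q) auto
    then have "integrable lebesgue (\<lambda>x. max 0 (Re (indicator Q x *\<^sub>R (c * b x - of_real t))))"
      unfolding set_integrable_def by (intro integrable_max integrable_zero integrable_Re)
    moreover have "max 0 (Re (indicator Q x *\<^sub>R (c * b x - of_real t))) = indicator Q x *\<^sub>R h c t x" for x
      by (simp add: h_def indicator_def)
    ultimately show ?thesis by (simp only: set_integrable_def)
  qed
  define \<gamma> where "\<gamma> = Complex \<alpha> \<beta>"
  have le: "norm (b x - \<gamma>) \<le> (h 1 \<alpha> x + h (-1) (-\<alpha>) x) + (h (-\<i>) \<beta> x + h \<i> (-\<beta>) x)" for x
  proof -
    have "norm (b x - \<gamma>) \<le> \<bar>Re (b x) - \<alpha>\<bar> + \<bar>Im (b x) - \<beta>\<bar>"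
      using cmod_le[of "b x - \<gamma>"] by (simp add: \<gamma>_def)
    also have "\<bar>Re (b x) - \<alpha>\<bar> = h 1 \<alpha> x + h (-1) (-\<alpha>) x"
      by (simp add: h_def max_def)
    also have "\<bar>Im (b x) - \<beta>\<bar> = h (-\<i>) \<beta> x + h \<i> (-\<beta>) x"
      by (simp add: h_def max_def)
    finally show ?thesis .
  qed
  have "set_integrable lebesgue Q (\<lambda>x. b x - \<gamma>)"
    by (intro set_integral_diff set_integrable_const_lmeasurable set_integrable_lmeasurable Q b)
  then have int: "set_integrable lebesgue Q (\<lambda>x. norm (b x - \<gamma>))"
    by (rule set_integrable_norm)
  have "(LINT x:Q|lebesgue. norm (b x - \<gamma>)) \<le>
      (LINT x:Q|lebesgue. (h 1 \<alpha> x + h (-1) (-\<alpha>) x) + (h (-\<i>) \<beta> x + h \<i> (-\<beta>) x))"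
    by (intro set_integral_mono int set_integral_add h_int le)
  also have "\<dots> = ((LINT x:Q|lebesgue. h 1 \<alpha> x) + (LINT x:Q|lebesgue. h (-1) (-\<alpha>) x))
      + ((LINT x:Q|lebesgue. h (-\<i>) \<beta> x) + (LINT x:Q|lebesgue. h \<i> (-\<beta>) x))"
    by (simp only: set_integral_add h_int)
  also have "\<dots> \<le> (50 * N * measure lebesgue Q + 50 * N * measure lebesgue Q)
      + (50 * N * measure lebesgue Q + 50 * N * measure lebesgue Q)"
  proof (intro add_mono)
    show "(LINT x:Q|lebesgue. h 1 \<alpha> x) \<le> 50 * N * measure lebesgue Q"
      unfolding h_def by (rule part) (use \<alpha> in simp_all)
    show "(LINT x:Q|lebesgue. h (-1) (-\<alpha>) x) \<le> 50 * N * measure lebesgue Q"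
      unfolding h_def by (rule part) (use \<alpha> in simp_all)
    show "(LINT x:Q|lebesgue. h (-\<i>) \<beta> x) \<le> 50 * N * measure lebesgue Q"
      unfolding h_def by (rule part) (use \<beta> in simp_all)
    show "(LINT x:Q|lebesgue. h \<i> (-\<beta>) x) \<le> 50 * N * measure lebesgue Q"
      unfolding h_def by (rule part) (use \<beta> in simp_all)
  qed
  finally have "(LINT x:Q|lebesgue. norm (b x - \<gamma>)) \<le> 200 * N * measure lebesgue Q"
    by simp
  then show thesis
    unfolding Q_def by (rule that)
qed

text \<open>
  Up to a factor \<open>2\<close> the mean is the best constant, as its distance from \<open>\<gamma>\<close> is at most the mean
  of \<open>\<bar>b - \<gamma>\<bar>\<close>.
\<close>
lemma mean_oscillation_le:
  assumes R: "R \<in> lmeasurable" "0 < measure lebesgue R" and b: "integrable lebesgue b"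
  shows "mean_oscillation b R \<le> 2 * (LINT x:R|lebesgue. norm (b x - \<gamma>)) / measure lebesgue R"
proof -
  define m where "m = measure lebesgue R"
  define \<mu> where "\<mu> = mean_on b R"
  have m: "0 < m" using R by (simp add: m_def)
  note const = set_integrable_const_lmeasurable[OF R(1)]
  note intb = set_integrable_lmeasurable[OF R(1) b]
  have int: "set_integrable lebesgue R (\<lambda>x. b x - c)" for c
    by (intro set_integral_diff intb const)
  have c_int: "(LINT x:R|lebesgue. c) = m *\<^sub>R c" for c :: "'b::{banach,second_countable_topology}"
    using integral_scaleR_left[of c lebesgue "indicator R"] R
    by (auto simp: set_lebesgue_integral_def m_def fmeasurable_def)
  have "(LINT x:R|lebesgue. b x - \<gamma>) = (LINT x:R|lebesgue. b x) - m *\<^sub>R \<gamma>"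
    by (simp add: set_integral_diff intb const c_int)
  also have "\<dots> = m *\<^sub>R (\<mu> - \<gamma>)"
    using m by (simp add: \<mu>_def mean_on_def m_def scaleR_diff_right)
  finally have "m * norm (\<mu> - \<gamma>) = norm (LINT x:R|lebesgue. b x - \<gamma>)"
    using m by simp
  also have "\<dots> \<le> (LINT x:R|lebesgue. norm (b x - \<gamma>))"
    by (rule set_integral_norm_bound[OF int])
  finally have 1: "m * norm (\<mu> - \<gamma>) \<le> (LINT x:R|lebesgue. norm (b x - \<gamma>))" .
  have "(LINT x:R|lebesgue. norm (b x - \<mu>)) \<le> (LINT x:R|lebesgue. norm (b x - \<gamma>) + norm (\<mu> - \<gamma>))"
  proof (intro set_integral_mono set_integral_add set_integrable_norm int const)
    show "norm (b x - \<mu>) \<le> norm (b x - \<gamma>) + norm (\<mu> - \<gamma>)" for x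
      using norm_triangle_ineq4[of "b x - \<gamma>" "\<mu> - \<gamma>"] by simp
  qed
  also have "\<dots> = (LINT x:R|lebesgue. norm (b x - \<gamma>)) + m * norm (\<mu> - \<gamma>)"
    by (simp add: set_integral_add set_integrable_norm int const c_int)
  finally have "(LINT x:R|lebesgue. norm (b x - \<mu>)) \<le> 2 * (LINT x:R|lebesgue. norm (b x - \<gamma>))"
    using 1 by simp
  then show ?thesis
    using m by (simp add: mean_oscillation_def \<mu>_def m_def divide_right_mono)
qed

text \<open>
  Rectangles are convex, and the frontier of a convex set is negligible, so taking closures does not
  change the measure.
\<close>
lemma rectangle_in_cbox_same_measure:
  assumes "R \<in> rectangles"
  obtains p q where "fst p < fst q" "snd p < snd q" "R \<in> lmeasurable" "R \<subseteq> cbox p q"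
    "measure lebesgue R = measure lebesgue (cbox p q)"
proof -
  have interval: "\<exists>s t. s < t \<and> closure I = cbox s t"
    if "is_interval I" "bounded I" "interior I \<noteq> {}" for I :: "real set"
  proof -
    have "is_interval (closure I)" "compact (closure I)"
      using that by (auto simp: is_interval_convex_1 convex_closure)
    then obtain s t where st: "closure I = cbox s t"
      using is_interval_compact by metis
    have "interior I \<subseteq> interior (cbox s t)"
      using st closure_subset interior_mono by metis
    then have "box s t \<noteq> {}" using that(3) by (auto simp: interior_cbox)
    then have "s < t" by auto
    with st show ?thesis by blast
  qed
  obtain I J where R: "R = I \<times> J" and I: "is_interval I" "bounded I" "interior I \<noteq> {}"
    and J: "is_interval J" "bounded J" "interior J \<noteq> {}"
    using assms by (auto simp: rectangles_def)
  obtain s t where st: "s < t" "closure I = cbox s t" using interval[OF I] by blast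
  obtain u v where uv: "u < v" "closure J = cbox u v" using interval[OF J] by blast
  have conv: "convex R" "bounded R"
    unfolding R using I J by (auto intro!: convex_Times bounded_Times simp: is_interval_convex_1)
  have cl: "closure R = cbox (s, u) (t, v)"
    by (simp add: R closure_Times st uv cbox_Pair_eq)
  show thesis
  proof (rule that[of "(s, u)" "(t, v)"])
    show "R \<in> lmeasurable" by (rule measurable_convex[OF conv])
    show "R \<subseteq> cbox (s, u) (t, v)" using closure_subset[of R] cl by simp
    show "measure lebesgue R = measure lebesgue (cbox (s, u) (t, v))"
      using measure_closure[OF conv(2) negligible_convex_frontier[OF conv(1)]] cl by simp
  qed (use st uv in auto)
qed

theorem corollary1p7:
  "\<exists>C::real. \<forall>b :: real \<times> real \<Rightarrow> complex.
     integrable lebesgue b \<longrightarrow> commutator_bounded b \<longrightarrow>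
       b \<in> little_bmo \<and> little_bmo_norm b \<le> C * commutator_norm b"
proof (intro exI[of _ 400] allI impI)
  fix b :: "real \<times> real \<Rightarrow> complex"
  assume b: "integrable lebesgue b" and bounded: "commutator_bounded b"
  have osc: "mean_oscillation b R \<le> 400 * N" if R: "R \<in> rectangles" and N: "N \<in> commutator_bounds b" for R N
  proof -
    obtain p q where pq: "fst p < fst q" "snd p < snd q" and RQ: "R \<in> lmeasurable" "R \<subseteq> cbox p q"
      "measure lebesgue R = measure lebesgue (cbox p q)"
      by (rule rectangle_in_cbox_same_measure[OF R])
    define m where "m = measure lebesgue (cbox p q)"
    have m: "0 < m"
      unfolding m_def using pq by (subst measure_cbox_real_prod) auto
    obtain \<gamma> where \<gamma>: "(LINT x:cbox p q|lebesgue. norm (b x - \<gamma>)) \<le> 200 * N * m"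
      unfolding m_def by (rule oscillation_on_cbox[OF b N pq])
    have "set_integrable lebesgue (cbox p q) (\<lambda>x. b x - \<gamma>)"
      by (intro set_integral_diff set_integrable_const_lmeasurable set_integrable_lmeasurable b) auto
    then have int: "set_integrable lebesgue (cbox p q) (\<lambda>x. norm (b x - \<gamma>))"
      by (rule set_integrable_norm)
    have "(LINT x:R|lebesgue. norm (b x - \<gamma>)) \<le> (LINT x:cbox p q|lebesgue. norm (b x - \<gamma>))"
      unfolding set_lebesgue_integral_def
    proof (rule integral_mono)
      show "integrable lebesgue (\<lambda>x. indicator R x *\<^sub>R norm (b x - \<gamma>))"
        using set_integrable_subset[OF int fmeasurableD[OF RQ(1)] RQ(2)] by (simp only: set_integrable_def)
      show "integrable lebesgue (\<lambda>x. indicator (cbox p q) x *\<^sub>R norm (b x - \<gamma>))"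
        using int by (simp only: set_integrable_def)
      show "indicator R x *\<^sub>R norm (b x - \<gamma>) \<le> indicator (cbox p q) x *\<^sub>R norm (b x - \<gamma>)" for x
        using RQ(2) by (intro scaleR_right_mono indicator_leI) auto
    qed
    with \<gamma> have "(LINT x:R|lebesgue. norm (b x - \<gamma>)) \<le> 200 * N * m" by linarith
    then have "2 * (LINT x:R|lebesgue. norm (b x - \<gamma>)) / m \<le> 400 * N"
      using m by (simp add: field_simps)
    moreover have "mean_oscillation b R \<le> 2 * (LINT x:R|lebesgue. norm (b x - \<gamma>)) / m"
      using mean_oscillation_le[OF RQ(1) _ b] RQ(3) m by (simp add: m_def)
    ultimately show ?thesis by linarith
  qed
  have ne: "commutator_bounds b \<noteq> {}" using bounded by (simp add: commutator_bounded_def)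
  then obtain N where N: "N \<in> commutator_bounds b" by blast
  have "locally_integrable b"
    unfolding locally_integrable_def set_integrable_def
    using b by (auto intro!: integrable_mult_indicator lmeasurable_compact fmeasurableD)
  moreover have bdd: "bdd_above (mean_oscillation b ` rectangles)"
    using osc N by (intro bdd_aboveI2) auto
  ultimately have "b \<in> little_bmo" by (simp add: little_bmo_def)
  have "{0..1} \<times> {0..1} \<in> rectangles"
    unfolding rectangles_def by (auto intro!: exI[of _ "{0..1::real}"])
  then have "rectangles \<noteq> {}" by blast
  then have "little_bmo_norm b \<le> 400 * N" if "N \<in> commutator_bounds b" for N
    unfolding little_bmo_norm_def using osc that by (intro cSUP_least) auto
  then have "little_bmo_norm b / 400 \<le> N" if "N \<in> commutator_bounds b" for N
    using that by fastforce
  then have "little_bmo_norm b / 400 \<le> commutator_norm b"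
    unfolding commutator_norm_def by (intro cInf_greatest ne)
  with \<open>b \<in> little_bmo\<close> show "b \<in> little_bmo \<and> little_bmo_norm b \<le> 400 * commutator_norm b"
    by simp
qed

end
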